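(* Consider the block-structured linear program $\max \sum_{i=1}^n c_i^T x^{(i)}$ subject to $\sum_{i=1}^n A_i x^{(i)}=b_0$, $x^{(i)}\in Q_i$ ($i=1,\dots,n$), and the corresponding integer program which additionally requires $x^{(i)}\in\mathbb{Z}^{t_i}$ for all $i$. Assume each $Q_i$ is an integral polyhedron of the form $Q_i=\operatorname{conv}\{x\in\mathbb{Z}^{t_i}: B_i x=b_i,\ x\ge 0\}$ with $B_i,b_i$ integral, that $G$ is an upper bound on the $\ell_1$-norm of every Graver basis element of every $B_i$, and that $\Delta$ is an upper bound on the absolute values of all entries of the $A_i$. Let $x^*\in\mathbb{R}^{t_1+\dots+t_n}$ be an optimal vertex solution of the linear program. If the integer program has an optimal solution, then there exists an optimal solution $z^*\in\mathbb{Z}^{t_1+\dots+t_n}$ of the integer program with \[ \|x^*-z^*\|_1\le (r\Delta G)^{O(r)}, \] where the constant in the $O(\cdot)$ is absolute.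
   Context: Here $c_i\in\mathbb{R}^{t_i}$, $A_i\in\mathbb{Z}^{r\times t_i}$, $b_0\in\mathbb{Z}^r$. The Graver basis of an integer matrix $C$ is the set of nonzero integral vectors $u\in\ker(C)$ that cannot be written as $u=v+w$ with $v,w$ nonzero integral elements of $\ker(C)$ that are sign-compatible with each other (vectors $v,w$ are sign-compatible if $v_jw_j\ge 0$ for all $j$). The matrix $B_i$ is the standard-form representation of $Q_i$. *)

theory Defs
  imports "HOL-Analysis.Analysis" "HOL-Library.Function_Algebras"
begin

text \<open>
  The dimensions vary inside the statement, so they are explicit numbers. A vector of length
  \<open>t\<close> is a function on \<^typ>\<open>nat\<close> that vanishes outside \<open>{..<t}\<close>; a block vector
  with \<open>n\<close> blocks of lengths \<open>t i\<close> is a function \<open>x\<close> with blocks \<open>x i\<close> that vanishes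
  outside the index range \<open>i < n\<close>, \<open>j < t i\<close>. An \<open>m \<times> t\<close> matrix is a function of row and
  column whose entries outside the index range are never used.
  With the pointwise operations these vectors form a linear subspace of a function space, so
  \<^const>\<open>hull\<close> and \<^const>\<open>extreme_point_of\<close> have their usual meaning.
\<close>

instantiation "fun" :: (type, real_vector) real_vector
begin

definition scaleR_fun :: "real \<Rightarrow> ('a \<Rightarrow> 'b) \<Rightarrow> 'a \<Rightarrow> 'b"
  where "scaleR_fun a f = (\<lambda>x. a *\<^sub>R f x)"

instance
  by standard (simp_all add: scaleR_fun_def plus_fun_def fun_eq_iff algebra_simps)

end

definition vecs :: "nat \<Rightarrow> (nat \<Rightarrow> 'a::zero) set"
  where "vecs t = {x. \<forall>j\<ge>t. x j = 0}"

definition mat_vec :: "nat \<Rightarrow> (nat \<Rightarrow> nat \<Rightarrow> int) \<Rightarrow> (nat \<Rightarrow> 'a::ring_1) \<Rightarrow> nat \<Rightarrow> 'a"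
  where "mat_vec t M x k = (\<Sum>j<t. of_int (M k j) * x j)"

definition int_kernel :: "nat \<Rightarrow> nat \<Rightarrow> (nat \<Rightarrow> nat \<Rightarrow> int) \<Rightarrow> (nat \<Rightarrow> int) set"
  where "int_kernel m t M = {u \<in> vecs t. \<forall>k<m. mat_vec t M u k = 0}"

definition sign_compatible :: "(nat \<Rightarrow> int) \<Rightarrow> (nat \<Rightarrow> int) \<Rightarrow> bool"
  where "sign_compatible v w \<longleftrightarrow> (\<forall>j. v j * w j \<ge> 0)"

definition graver_basis :: "nat \<Rightarrow> nat \<Rightarrow> (nat \<Rightarrow> nat \<Rightarrow> int) \<Rightarrow> (nat \<Rightarrow> int) set"
  where "graver_basis m t M =
    {u \<in> int_kernel m t M - {0}.
      \<not> (\<exists>v \<in> int_kernel m t M - {0}. \<exists>w \<in> int_kernel m t M - {0}.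
            sign_compatible v w \<and> u = v + w)}"

definition integer_points ::
    "nat \<Rightarrow> nat \<Rightarrow> (nat \<Rightarrow> nat \<Rightarrow> int) \<Rightarrow> (nat \<Rightarrow> int) \<Rightarrow> (nat \<Rightarrow> real) set"
  where "integer_points m t B b =
    {x \<in> vecs t. (\<forall>j<t. x j \<in> \<int> \<and> x j \<ge> 0) \<and> (\<forall>k<m. mat_vec t B x k = of_int (b k))}"

definition lp_feasible ::
    "nat \<Rightarrow> nat \<Rightarrow> (nat \<Rightarrow> nat) \<Rightarrow> (nat \<Rightarrow> nat \<Rightarrow> nat \<Rightarrow> int) \<Rightarrow> (nat \<Rightarrow> int) \<Rightarrow>
      (nat \<Rightarrow> (nat \<Rightarrow> real) set) \<Rightarrow> (nat \<Rightarrow> nat \<Rightarrow> real) set"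
  where "lp_feasible n r t A b\<^sub>0 Q =
    {x \<in> vecs n. (\<forall>i<n. x i \<in> Q i) \<and>
       (\<forall>k<r. (\<Sum>i<n. mat_vec (t i) (A i) (x i) k) = of_int (b\<^sub>0 k))}"

definition ip_feasible ::
    "nat \<Rightarrow> nat \<Rightarrow> (nat \<Rightarrow> nat) \<Rightarrow> (nat \<Rightarrow> nat \<Rightarrow> nat \<Rightarrow> int) \<Rightarrow> (nat \<Rightarrow> int) \<Rightarrow>
      (nat \<Rightarrow> (nat \<Rightarrow> real) set) \<Rightarrow> (nat \<Rightarrow> nat \<Rightarrow> real) set"
  where "ip_feasible n r t A b\<^sub>0 Q =
    {x \<in> lp_feasible n r t A b\<^sub>0 Q. \<forall>i<n. \<forall>j<t i. x i j \<in> \<int>}"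

definition block_objective ::
    "nat \<Rightarrow> (nat \<Rightarrow> nat) \<Rightarrow> (nat \<Rightarrow> nat \<Rightarrow> real) \<Rightarrow> (nat \<Rightarrow> nat \<Rightarrow> real) \<Rightarrow> real"
  where "block_objective n t c x = (\<Sum>i<n. \<Sum>j<t i. c i j * x i j)"

definition norm1 :: "nat \<Rightarrow> (nat \<Rightarrow> 'a::linordered_idom) \<Rightarrow> 'a"
  where "norm1 t x = (\<Sum>j<t. \<bar>x j\<bar>)"

definition block_norm1 :: "nat \<Rightarrow> (nat \<Rightarrow> nat) \<Rightarrow> (nat \<Rightarrow> nat \<Rightarrow> real) \<Rightarrow> real"
  where "block_norm1 n t x = (\<Sum>i<n. norm1 (t i) (x i))"

end

theory Submission
  imports Defs
begin

text \<open>
  Let \<open>x\<close> be the optimal vertex. A direction along which one can move from \<open>x\<close> both ways inside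
  \<open>\<Prod> Q\<^sub>i\<close> is called free; since \<open>x\<close> is extreme, a free direction that does not change the linking
  constraints is zero. Hence a Graver element in a free direction of a block is determined, together
  with its block, by its image under \<open>A\<^sub>i\<close>, which leaves at most \<open>(2 \<Delta> G + 1)^r\<close> such pairs.
  Writing \<open>x\<close> as an integer point plus a combination of these elements and rounding the coefficients
  down gives an integer point \<open>v\<close> close to \<open>x\<close> in the minimal face of \<open>\<Prod> Q\<^sub>i\<close> containing \<open>x\<close>.

  Let \<open>z\<close> be an integer optimum that minimizes the distance to \<open>v\<close>, and decompose \<open>z - v\<close>
  conformally into Graver elements. A subfamily whose images under the \<open>A\<^sub>i\<close> sum to zero could be
  subtracted from \<open>z\<close> and, after scaling, added to \<open>x\<close>, keeping both feasible; by optimality this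
  would produce a closer integer optimum. So no nonempty subfamily has image sum zero, and the
  Steinitz lemma bounds the number of Graver elements.
\<close>

subsection \<open>The Steinitz lemma\<close>

text \<open>Gaussian elimination: an unknown \<open>p\<close> with nonzero coefficient in the last
  equation is solved for and eliminated, which leaves one equation and one unknown fewer.\<close>

lemma homogeneous_system_nontrivial_solution:
  fixes w :: "nat \<Rightarrow> 'i \<Rightarrow> real"
  assumes "finite F" "m < card F"
  shows "\<exists>y. (\<exists>i\<in>F. y i \<noteq> 0) \<and> (\<forall>k<m. (\<Sum>i\<in>F. y i * w k i) = 0)"
  using assms
proof (induction m arbitrary: F w)
  case 0
  then have "F \<noteq> {}" by auto
  then show ?case by (intro exI[of _ "\<lambda>_. 1"]) auto
next
  case (Suc m)
  show ?case
  proof (cases "\<forall>i\<in>F. w m i = 0")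
    case True
    with Suc.IH[of F w] Suc.prems obtain y where
      "\<exists>i\<in>F. y i \<noteq> 0" "\<forall>k<m. (\<Sum>i\<in>F. y i * w k i) = 0" by auto
    with True show ?thesis by (intro exI[of _ y]) (auto simp: less_Suc_eq)
  next
    case False
    then obtain p where p: "p \<in> F" "w m p \<noteq> 0" by auto
    define F' where "F' = F - {p}"
    \<comment> \<open>Row \<open>k\<close> minus the multiple of row \<open>m\<close> that cancels
      the coefficient of \<open>p\<close>.\<close>
    define w' where "w' k i = w k i - w k p * w m i / w m p" for k i
    have F': "finite F'" "m < card F'" "p \<notin> F'" "F = insert p F'"
      using Suc.prems p by (auto simp: F'_def)
    from Suc.IH[OF F'(1,2), of w'] obtain y where
      y: "\<exists>i\<in>F'. y i \<noteq> 0" "\<forall>k<m. (\<Sum>i\<in>F'. y i * w' k i) = 0" by blast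
    \<comment> \<open>The value \<open>- s\<close> at \<open>p\<close> is forced by equation
      \<open>m\<close>.\<close>
    define s where "s = (\<Sum>i\<in>F'. y i * w m i) / w m p"
    define y' where "y' i = (if i = p then - s else y i)" for i
    have split: "(\<Sum>i\<in>F. y' i * w k i) = - s * w k p + (\<Sum>i\<in>F'. y i * w k i)" for k
    proof -
      have "(\<Sum>i\<in>F'. y' i * w k i) = (\<Sum>i\<in>F'. y i * w k i)"
        using F'(3) by (intro sum.cong) (auto simp: y'_def)
      then show ?thesis using F' by (simp add: y'_def)
    qed
    have "(\<Sum>i\<in>F. y' i * w k i) = 0" if "k < Suc m" for k
    proof (cases "k = m")
      case True
      then show ?thesis using p by (simp add: split s_def)
    next
      case False
      with that y(2) have "0 = (\<Sum>i\<in>F'. y i * w' k i)" by simp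
      also have "\<dots> = (\<Sum>i\<in>F'. y i * w k i) - (\<Sum>i\<in>F'. w k p / w m p * (y i * w m i))"
        unfolding sum_subtractf[symmetric] by (intro sum.cong) (auto simp: w'_def algebra_simps)
      also have "\<dots> = (\<Sum>i\<in>F. y' i * w k i)"
        unfolding split sum_distrib_left[symmetric] by (simp add: s_def)
      finally show ?thesis by simp
    qed
    moreover have "\<exists>i\<in>F. y' i \<noteq> 0"
      using y(1) F' by (auto simp: y'_def)
    ultimately show ?thesis by blast
  qed
qed

text \<open>As long as more than \<open>m\<close> entries are fractional, a nonzero direction
  supported on them leaves all \<open>m\<close> sums fixed. Following it until some entry first
  reaches 0 or 1 lowers the number of fractional entries, as in the passage to a basic
  solution.\<close>

lemma few_fractional_entries:
  fixes w :: "nat \<Rightarrow> 'i \<Rightarrow> real" and l :: "'i \<Rightarrow> real"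
  assumes "finite A" "\<forall>i\<in>A. 0 \<le> l i \<and> l i \<le> 1"
  shows "\<exists>l'. (\<forall>i\<in>A. 0 \<le> l' i \<and> l' i \<le> 1) \<and>
    (\<forall>k<m. (\<Sum>i\<in>A. l' i * w k i) = (\<Sum>i\<in>A. l i * w k i)) \<and>
    card {i\<in>A. 0 < l' i \<and> l' i < 1} \<le> m"
  using assms(2)
proof (induction "card {i\<in>A. 0 < l i \<and> l i < 1}" arbitrary: l rule: less_induct)
  case less
  define F where "F = {i\<in>A. 0 < l i \<and> l i < 1}"
  have F: "finite F" "F \<subseteq> A" using assms by (auto simp: F_def)
  show ?case
  proof (cases "card F \<le> m")
    case True
    then show ?thesis using less.prems by (intro exI[of _ l]) (auto simp: F_def)
  next
    case False
    with homogeneous_system_nontrivial_solution[OF F(1), of m w] obtain y where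
      y: "\<exists>i\<in>F. y i \<noteq> 0" "\<forall>k<m. (\<Sum>i\<in>F. y i * w k i) = 0" by auto
    \<comment> \<open>The time at which entry \<open>i\<close> reaches 1 when it increases, or 0
      when it decreases; the minimum \<open>T\<close> is the first such event.\<close>
    define step where "step i = (if y i > 0 then (1 - l i) / y i else l i / - y i)" for i
    define H where "H = {i\<in>F. y i \<noteq> 0}"
    have H: "finite H" "H \<noteq> {}" using F y(1) by (auto simp: H_def)
    define T where "T = Min (step ` H)"
    have "T \<in> step ` H" unfolding T_def using H by (intro Min_in) auto
    then obtain p where p: "p \<in> H" "T = step p" by auto
    have T_le: "T \<le> step i" if "i \<in> H" for i
      unfolding T_def using that H by (intro Min_le) auto
    have T0: "T \<ge> 0" using p by (auto simp: step_def H_def F_def divide_simps)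
    define l' where "l' i = (if i \<in> F then l i + T * y i else l i)" for i
    have range: "0 \<le> l' i \<and> l' i \<le> 1" if "i \<in> A" for i
    proof (cases "i \<in> H")
      case True
      then have i: "i \<in> F" "y i \<noteq> 0" "0 < l i" "l i < 1" by (auto simp: H_def F_def)
      show ?thesis
      proof (cases "y i > 0")
        case True
        then have "T * y i \<le> 1 - l i" using T_le[OF \<open>i \<in> H\<close>] by (simp add: step_def field_simps)
        then show ?thesis using True T0 i by (simp add: l'_def add_nonneg_nonneg)
      next
        case False
        with i have "y i < 0" by simp
        then have "T * - y i \<le> l i" using T_le[OF \<open>i \<in> H\<close>] by (simp add: step_def field_simps)
        moreover have "T * - y i \<ge> 0" using T0 \<open>y i < 0\<close> by (intro mult_nonneg_nonneg) auto
        ultimately show ?thesis using i by (simp add: l'_def)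
      qed
    next
      case False
      then show ?thesis using less.prems that by (auto simp: l'_def H_def)
    qed
    have sums: "(\<Sum>i\<in>A. l' i * w k i) = (\<Sum>i\<in>A. l i * w k i)" if "k < m" for k
    proof -
      have "(\<Sum>i\<in>A. l' i * w k i) = (\<Sum>i\<in>A. l i * w k i + (if i \<in> F then T * (y i * w k i) else 0))"
        by (intro sum.cong) (auto simp: l'_def algebra_simps)
      also have "\<dots> = (\<Sum>i\<in>A. l i * w k i) + (\<Sum>i\<in>F. T * (y i * w k i))"
        using F assms(1) by (simp add: sum.distrib sum.If_cases Int_absorb1)
      also have "(\<Sum>i\<in>F. T * (y i * w k i)) = 0"
        using y(2) that by (simp add: sum_distrib_left[symmetric])
      finally show ?thesis by simp
    qed
    have "l' p = 0 \<or> l' p = 1" using p by (auto simp: l'_def H_def step_def)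
    moreover have "p \<in> F" using p by (auto simp: H_def)
    moreover have "{i\<in>A. 0 < l' i \<and> l' i < 1} \<subseteq> F"
      by (auto simp: l'_def F_def split: if_splits)
    ultimately have "{i\<in>A. 0 < l' i \<and> l' i < 1} \<subset> F" by fastforce
    then have "card {i\<in>A. 0 < l' i \<and> l' i < 1} < card F" using F by (intro psubset_card_mono)
    from less.hyps[of l', folded F_def, OF this] range sums show ?thesis by auto
  qed
qed

text \<open>The invariant of the Grinberg--Sevastyanov argument.\<close>

definition steinitz_set :: "nat \<Rightarrow> ('i \<Rightarrow> nat \<Rightarrow> real) \<Rightarrow> 'i set \<Rightarrow> bool"
  where "steinitz_set r a A \<longleftrightarrow> card A \<le> r \<or>
    (\<exists>l. (\<forall>i\<in>A. 0 \<le> l i \<and> l i \<le> 1) \<and> (\<Sum>i\<in>A. l i) = real (card A) - real r \<and>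
      (\<forall>k<r. (\<Sum>i\<in>A. l i * a i k) = 0))"

text \<open>In the second case the weighted sum is zero, so the sum equals the one with weights
  \<open>1 - l i\<close>; these are nonnegative and add up to \<open>r\<close>.\<close>

lemma steinitz_set_sum_bound:
  assumes "steinitz_set r a A" "finite A" "\<forall>i\<in>A. \<bar>a i k\<bar> \<le> K" "k < r" "K \<ge> 0"
  shows "\<bar>\<Sum>i\<in>A. a i k\<bar> \<le> K * r"
  using assms(1) unfolding steinitz_set_def
proof
  assume "card A \<le> r"
  have "\<bar>\<Sum>i\<in>A. a i k\<bar> \<le> (\<Sum>i\<in>A. K)"
    using assms(3) by (intro order.trans[OF sum_abs] sum_mono) auto
  also have "\<dots> = K * card A" by simp
  also have "\<dots> \<le> K * r" using \<open>card A \<le> r\<close> assms(5) by (intro mult_left_mono) auto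
  finally show ?thesis .
next
  assume "\<exists>l. (\<forall>i\<in>A. 0 \<le> l i \<and> l i \<le> 1) \<and> (\<Sum>i\<in>A. l i) = real (card A) - real r \<and>
      (\<forall>k<r. (\<Sum>i\<in>A. l i * a i k) = 0)"
  then obtain l where l: "\<forall>i\<in>A. 0 \<le> l i \<and> l i \<le> 1" "(\<Sum>i\<in>A. l i) = real (card A) - real r"
    "(\<Sum>i\<in>A. l i * a i k) = 0" using assms(4) by blast
  have "\<bar>\<Sum>i\<in>A. a i k\<bar> = \<bar>\<Sum>i\<in>A. (1 - l i) * a i k\<bar>"
    using l(3) by (simp add: left_diff_distrib sum_subtractf)
  also have "\<dots> \<le> (\<Sum>i\<in>A. (1 - l i) * K)"
    using assms(3) l(1) by (intro order.trans[OF sum_abs] sum_mono) (auto simp: abs_mult intro!: mult_mono)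
  also have "\<dots> = K * r"
    using l(2) by (simp add: sum_distrib_right[symmetric] sum_subtractf)
  finally show ?thesis .
qed

text \<open>After lowering the total weight by one, the weights are made integral up to
  \<open>r + 1\<close> entries. Counting then shows that some weight is zero, and that element can
  go.\<close>

lemma steinitz_set_remove:
  assumes "steinitz_set r a A" "finite A" "A \<noteq> {}"
  shows "\<exists>p\<in>A. steinitz_set r a (A - {p})"
proof (cases "card A \<le> r")
  case True
  then show ?thesis using assms by (auto simp: steinitz_set_def card_Diff_singleton_if)
next
  case False
  with assms(1) obtain l where l: "\<forall>i\<in>A. 0 \<le> l i \<and> l i \<le> 1"
    "(\<Sum>i\<in>A. l i) = real (card A) - real r" "\<forall>k<r. (\<Sum>i\<in>A. l i * a i k) = 0"
    by (auto simp: steinitz_set_def)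
  define q where "q = (real (card A) - 1 - r) / (real (card A) - r)"
  have q: "0 \<le> q" "q \<le> 1" "q * (real (card A) - r) = real (card A) - 1 - r"
    using False by (auto simp: q_def field_simps)
  \<comment> \<open>Row \<open>r\<close> is constant 1, so that the total weight is preserved along
    with the \<open>r\<close> coordinate sums.\<close>
  define w where "w k i = (if k = r then 1 else a i k)" for k i
  have "\<forall>i\<in>A. 0 \<le> q * l i \<and> q * l i \<le> 1" using l(1) q by (auto intro: mult_le_one)
  from few_fractional_entries[OF assms(2) this, of "Suc r" w] obtain u where
    u: "\<forall>i\<in>A. 0 \<le> u i \<and> u i \<le> 1"
      "\<And>k. k < Suc r \<Longrightarrow> (\<Sum>i\<in>A. u i * w k i) = (\<Sum>i\<in>A. q * l i * w k i)"
      "card {i\<in>A. 0 < u i \<and> u i < 1} \<le> Suc r" by blast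
  have u_sum: "(\<Sum>i\<in>A. u i) = real (card A) - 1 - r"
    using u(2)[of r] l(2) q by (simp add: w_def sum_distrib_left[symmetric])
  have u_zero: "(\<Sum>i\<in>A. u i * a i k) = 0" if "k < r" for k
    using u(2)[of k] l(3) that by (simp add: w_def sum_distrib_left[symmetric] mult.assoc)
  have "\<exists>p\<in>A. u p = 0"
  proof (rule ccontr)
    assume "\<not> ?thesis"
    with u(1) have pos: "\<forall>i\<in>A. 0 < u i" by force
    define F where "F = {i\<in>A. u i < 1}"
    have F: "finite F" "F \<subseteq> A" "card F \<le> Suc r"
    proof -
      have "{i\<in>A. 0 < u i \<and> u i < 1} = F" using pos by (auto simp: F_def)
      then show "finite F" "F \<subseteq> A" "card F \<le> Suc r" using u(3) assms(2) by (auto simp: F_def)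
    qed
    \<comment> \<open>The deficits \<open>1 - u i\<close> add up to \<open>r + 1\<close>, but only
      at most \<open>r + 1\<close> of them are nonzero and each is strictly below 1.\<close>
    have "(\<Sum>i\<in>A. 1 - u i) = (\<Sum>i\<in>F. 1 - u i)"
      using F u(1) assms(2) by (intro sum.mono_neutral_right) (force simp: F_def)+
    then have eq: "(\<Sum>i\<in>F. 1 - u i) = 1 + real r"
      using u_sum by (simp add: sum_subtractf)
    show False
    proof (cases "F = {}")
      case True
      then show ?thesis using eq by simp
    next
      case ne: False
      have "(\<Sum>i\<in>F. 1 - u i) < (\<Sum>i\<in>F. 1)"
        using pos F ne by (intro sum_strict_mono) auto
      then show ?thesis using eq F(3) by simp
    qed
  qed
  then obtain p where p: "p \<in> A" "u p = 0" by auto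
  have drop: "(\<Sum>i\<in>A - {p}. u i * f i) = (\<Sum>i\<in>A. u i * f i)" for f :: "'a \<Rightarrow> real"
    using p assms(2) by (simp add: sum_diff1)
  have "steinitz_set r a (A - {p})"
    unfolding steinitz_set_def
  proof (intro disjI2 exI[of _ u] conjI)
    show "sum u (A - {p}) = real (card (A - {p})) - real r"
      using drop[of "\<lambda>_. 1"] u_sum p assms(2) False by (simp add: of_nat_diff)
  qed (use u(1) u_zero drop in auto)
  with p show ?thesis by blast
qed

text \<open>The ordering is built from the back: the removed element becomes the last one, so every
  prefix keeps the invariant.\<close>

lemma steinitz_set_ordering:
  assumes "finite A" "steinitz_set r a A"
  shows "\<exists>xs. distinct xs \<and> set xs = A \<and> (\<forall>m\<le>length xs. steinitz_set r a (set (take m xs)))"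
  using assms
proof (induction "card A" arbitrary: A)
  case 0
  then show ?case by (intro exI[of _ "[]"]) auto
next
  case (Suc c)
  then have "A \<noteq> {}" by auto
  from steinitz_set_remove[OF Suc.prems(2,1) this] obtain p where
    p: "p \<in> A" "steinitz_set r a (A - {p})" by blast
  have "c = card (A - {p})" using p Suc by auto
  with Suc.hyps(1)[of "A - {p}"] p Suc.prems obtain xs where
    xs: "distinct xs" "set xs = A - {p}" "\<forall>m\<le>length xs. steinitz_set r a (set (take m xs))"
    by auto
  have "steinitz_set r a (set (take m (xs @ [p])))" if "m \<le> length (xs @ [p])" for m
  proof (cases "m \<le> length xs")
    case False
    with that have "m = Suc (length xs)" by simp
    moreover have "insert p (A - {p}) = A" using p(1) by auto
    ultimately show ?thesis using p Suc.prems xs by simp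
  qed (use xs in auto)
  moreover have "distinct (xs @ [p])" "set (xs @ [p]) = A" using xs p by auto
  ultimately show ?case by blast
qed

text \<open>Because the whole family sums to zero, equal weights
  \<open>(card A - r) / card A\<close> start the removal process.\<close>

theorem steinitz:
  fixes a :: "'i \<Rightarrow> nat \<Rightarrow> real"
  assumes "finite A" "\<forall>i\<in>A. \<forall>k<r. \<bar>a i k\<bar> \<le> K" "\<forall>k<r. (\<Sum>i\<in>A. a i k) = 0" "K \<ge> 0"
  shows "\<exists>xs. distinct xs \<and> set xs = A \<and>
    (\<forall>m\<le>length xs. \<forall>k<r. \<bar>\<Sum>i\<in>set (take m xs). a i k\<bar> \<le> K * r)"
proof -
  have "steinitz_set r a A"
  proof (cases "card A \<le> r")
    case False
    then have "(real (card A) - r) / card A * card A = real (card A) - r" by auto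
    then show ?thesis unfolding steinitz_set_def using False assms(3)
      by (intro disjI2 exI[of _ "\<lambda>_. (real (card A) - r) / card A"])
        (auto simp: sum_distrib_left[symmetric] divide_le_eq_1 simp del: times_divide_eq_left)
  qed (simp add: steinitz_set_def)
  from steinitz_set_ordering[OF assms(1) this] obtain xs where
    xs: "distinct xs" "set xs = A" "\<forall>m\<le>length xs. steinitz_set r a (set (take m xs))" by blast
  have "\<bar>\<Sum>i\<in>set (take m xs). a i k\<bar> \<le> K * r" if "m \<le> length xs" "k < r" for m k
    using xs(3) that assms(2,4) xs(2) set_take_subset[of m xs]
    by (intro steinitz_set_sum_bound) auto
  with xs show ?thesis by blast
qed

text \<open>The Steinitz ordering keeps the partial sums of the \<open>a i\<close> close to the segment from \<open>0\<close> to their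
  total. Cutting this segment into \<open>M\<close> pieces makes the number of lattice points close to it
  linear in \<open>M\<close>; two equal partial sums differ by a subfamily with sum zero.\<close>

lemma zero_sum_subfamily:
  fixes a :: "'i \<Rightarrow> nat \<Rightarrow> int"
  assumes "finite I" "\<forall>i\<in>I. \<forall>k<r. \<bar>a i k\<bar> \<le> int K"
    and total: "\<forall>k<r. \<bar>\<Sum>i\<in>I. a i k\<bar> \<le> int (K * M)"
    and "M \<ge> 1" and big: "card I \<ge> (M + 1) * (4 * K * r + 2 * K + 2) ^ r"
  shows "\<exists>J\<subseteq>I. J \<noteq> {} \<and> (\<forall>k<r. (\<Sum>i\<in>J. a i k) = 0)"
proof -
  define N where "N = card I"
  have "(4 * K * r + 2 * K + 2) ^ r \<ge> 1" by simp
  then have "(M + 1) * 1 \<le> (M + 1) * (4 * K * r + 2 * K + 2) ^ r" by (intro mult_left_mono) auto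
  with big have N: "N \<ge> M" "N > 0" using assms(4) by (auto simp: N_def)
  define d where "d k = (\<Sum>i\<in>I. a i k)" for k
  have d: "\<bar>real_of_int (d k)\<bar> \<le> K * M" if "k < r" for k
  proof -
    have "real_of_int \<bar>d k\<bar> \<le> real_of_int (int (K * M))"
      unfolding of_int_le_iff using total that by (auto simp: d_def)
    then show ?thesis by simp
  qed
  \<comment> \<open>Centring makes the sum zero, as \<open>steinitz\<close> requires. The bound
    doubles to \<open>2 * K\<close>, since \<open>N \<ge> M\<close> keeps the average
    \<open>d k / N\<close> within \<open>K\<close>.\<close>
  define v where "v i k = real_of_int (a i k) - d k / N" for i k
  have v_bound: "\<bar>v i k\<bar> \<le> 2 * K" if "i \<in> I" "k < r" for i k
  proof -
    have "\<bar>d k / N\<bar> = \<bar>real_of_int (d k)\<bar> / N" by simp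
    also have "\<dots> \<le> K * M / N" using d[OF that(2)] by (intro divide_right_mono) auto
    also have "\<dots> \<le> K * N / N"
      using N by (simp add: divide_le_eq mult_left_mono del: nonzero_mult_div_cancel_right)
    also have "\<dots> = K" using N by simp
    finally have "\<bar>d k / N\<bar> \<le> K" .
    moreover have "\<bar>real_of_int (a i k)\<bar> \<le> K"
      using assms(2) that by (metis of_int_abs of_int_le_iff of_int_of_nat_eq)
    ultimately show ?thesis unfolding v_def by linarith
  qed
  have v_sum: "(\<Sum>i\<in>I. v i k) = 0" for k
    using N by (simp add: v_def sum_subtractf d_def N_def)
  from steinitz[of I r v "2 * K"] assms(1) v_bound v_sum obtain xs where
    xs: "distinct xs" "set xs = I"
      "\<And>m k. m \<le> length xs \<Longrightarrow> k < r \<Longrightarrow> \<bar>\<Sum>i\<in>set (take m xs). v i k\<bar> \<le> 2 * K * r"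
    by auto
  have len: "length xs = N" using xs(1,2) by (simp add: N_def distinct_card[symmetric])
  define p where "p m k = (\<Sum>i\<in>set (take m xs). a i k)" for m k
  have p_near: "\<bar>p m k - m * d k / N\<bar> \<le> 2 * K * r" if "m \<le> N" "k < r" for m k
  proof -
    have "card (set (take m xs)) = m" using that xs(1) len by (simp add: distinct_card)
    then have "(\<Sum>i\<in>set (take m xs). v i k) = p m k - m * d k / N"
      by (simp add: v_def p_def sum_subtractf)
    then show ?thesis using xs(3)[of m k] that len by simp
  qed
  \<comment> \<open>\<open>\<tau> m\<close> is the piece of the segment near which the partial sum
    \<open>p m\<close> lies, and \<open>e m\<close> its integer offset from the rounded starting
    point of that piece.\<close>
  define \<tau> where "\<tau> m = m * M div N" for m
  define e where "e m k = p m k - \<lfloor>\<tau> m * d k / M\<rfloor>" for m k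
  \<comment> \<open>The summand \<open>2 * K * r\<close> is the Steinitz deviation and
    \<open>K\<close> the extent of one piece in each coordinate. The floor costs one more unit on
    the upper side.\<close>
  define W where "W = int (2 * K * r + K)"
  have e_range: "e m k \<in> {- W..W + 1}" if "m \<le> N" "k < r" for m k
  proof -
    have "real (\<tau> m) \<le> m * M / N" unfolding \<tau>_def by (metis of_nat_div_le_of_nat of_nat_mult)
    moreover have "m * M / N \<le> \<tau> m + 1"
    proof -
      have "m * M < N * (\<tau> m + 1)" unfolding \<tau>_def using N(2)
        by (metis add.commute mult.commute mult_Suc_right dividend_less_times_div Suc_eq_plus1)
      then have "real (m * M) < real (N * (\<tau> m + 1))" unfolding of_nat_less_iff .
      then show ?thesis using N by (simp add: field_simps)
    qed
    ultimately have \<tau>: "\<bar>m * M / N - \<tau> m\<bar> \<le> 1" by simp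
    have "m * d k / N - \<tau> m * d k / M = (m * M / N - \<tau> m) * (d k / M)"
      using assms(4) N by (simp add: field_simps)
    then have "\<bar>m * d k / N - \<tau> m * d k / M\<bar> = \<bar>m * M / N - \<tau> m\<bar> * \<bar>d k / M\<bar>"
      by (simp only: abs_mult)
    also have "\<dots> \<le> 1 * K"
      unfolding of_nat_mult using \<tau> d[OF that(2)] assms(4) by (intro mult_mono) (auto simp: field_simps)
    finally have "\<bar>p m k - \<tau> m * d k / M\<bar> \<le> 2 * K * r + K"
      using p_near[OF that] by (simp add: abs_le_iff)
    moreover have "a - \<lfloor>y\<rfloor> \<in> {- int n..int n + 1}" if "\<bar>real_of_int a - y\<bar> \<le> real n" for a y n
    proof -
      have "\<lfloor>y\<rfloor> \<le> a + int n" "a - int n - 1 \<le> \<lfloor>y\<rfloor>"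
        using that by (simp_all add: floor_le_iff le_floor_iff)
      then show ?thesis by auto
    qed
    ultimately show ?thesis unfolding e_def W_def by blast
  qed
  \<comment> \<open>Pigeonhole: the \<open>N + 1\<close> prefix lengths are mapped into at most
    \<open>N\<close> pairs, as each coordinate of \<open>e\<close> has \<open>2 * W + 2\<close>
    possible values.\<close>
  define X where "X = {..M} \<times> ({..<r} \<rightarrow>\<^sub>E {- W..W + 1})"
  define f where "f m = (\<tau> m, restrict (e m) {..<r})" for m
  have "f ` {..N} \<subseteq> X"
  proof -
    have "\<tau> m \<le> M" if "m \<le> N" for m
    proof -
      have "m * M div N \<le> N * M div N" using that by (intro div_le_mono mult_right_mono) auto
      then show ?thesis using N by (simp add: \<tau>_def)
    qed
    then show ?thesis using e_range
      by (simp add: image_subset_iff f_def X_def restrict_PiE_iff del: atLeastAtMost_iff)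
  qed
  moreover have "card X = (M + 1) * (4 * K * r + 2 * K + 2) ^ r"
  proof -
    have "W + 1 - (- W) + 1 = int (4 * K * r + 2 * K + 2)" by (simp add: W_def algebra_simps)
    then have "card {- W..W + 1} = 4 * K * r + 2 * K + 2"
      unfolding card_atLeastAtMost_int by (metis nat_int)
    then show ?thesis by (simp add: X_def card_cartesian_product card_PiE)
  qed
  moreover have "finite X" by (auto simp: X_def intro!: finite_PiE)
  ultimately have "\<not> inj_on f {..N}"
    using big card_mono[of X "f ` {..N}"] card_image[of f "{..N}"] by (auto simp: N_def)
  then obtain m m' where m: "m < m'" "m' \<le> N" "f m = f m'"
    by (auto simp: inj_on_def) (metis linorder_neqE_nat)
  have p_eq: "p m k = p m' k" if "k < r" for k
  proof -
    have "e m k = e m' k" "\<tau> m = \<tau> m'"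
      using m(3) that unfolding f_def by (auto dest!: fun_cong[of _ _ k])
    then show ?thesis by (simp add: e_def)
  qed
  define J where "J = set (take m' xs) - set (take m xs)"
  have sub: "set (take m xs) \<subseteq> set (take m' xs)" using m(1) by (simp add: set_take_subset_set_take)
  have "card (set (take m xs)) < card (set (take m' xs))"
    using m xs(1) len by (simp add: distinct_card)
  then have "J \<noteq> {}" unfolding J_def using card_mono[of "set (take m xs)" "set (take m' xs)"] by auto
  moreover have "J \<subseteq> I" using xs(2) set_take_subset[of m' xs] by (auto simp: J_def)
  moreover have "(\<Sum>i\<in>J. a i k) = 0" if "k < r" for k
    using p_eq[OF that] sub by (simp add: J_def p_def sum_diff)
  ultimately show ?thesis by blast
qed

subsection \<open>Free directions and Graver bases\<close>

lemma sum_fun_apply: "(\<Sum>i\<in>A. f i) x = (\<Sum>i\<in>A. f i x)"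
  for f :: "'i \<Rightarrow> 'b \<Rightarrow> 'c::comm_monoid_add"
  by (induction A rule: infinite_finite_induct) auto

text \<open>For convex \<open>S\<close> and \<open>x\<close> in \<open>S\<close> this is the linear
  space parallel to the minimal face of \<open>S\<close> containing \<open>x\<close>.\<close>

definition free_dirs :: "'a::real_vector set \<Rightarrow> 'a \<Rightarrow> 'a set"
  where "free_dirs S x = {d. \<exists>e>0. x + e *\<^sub>R d \<in> S \<and> x - e *\<^sub>R d \<in> S}"

lemma convex_shorter_step:
  assumes "convex S" "x \<in> S" "x + e *\<^sub>R d \<in> S" "0 \<le> f" "f \<le> e" "e > 0"
  shows "x + f *\<^sub>R d \<in> S"
proof -
  have "(1 - f / e) *\<^sub>R x + (f / e) *\<^sub>R (x + e *\<^sub>R d) \<in> S"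
    using assms by (intro convexD) (auto simp: field_simps)
  also have "(1 - f / e) *\<^sub>R x + (f / e) *\<^sub>R (x + e *\<^sub>R d) = x + f *\<^sub>R d"
    using assms by (simp add: algebra_simps)
  finally show ?thesis .
qed

lemma free_dirs_shorter_step:
  assumes "convex S" "x \<in> S" "d \<in> free_dirs S x"
  obtains e where "e > 0" "\<And>f. 0 \<le> f \<Longrightarrow> f \<le> e \<Longrightarrow> x + f *\<^sub>R d \<in> S \<and> x - f *\<^sub>R d \<in> S"
proof -
  from assms(3) obtain e where e: "e > 0" "x + e *\<^sub>R d \<in> S" "x + e *\<^sub>R (- d) \<in> S"
    by (auto simp: free_dirs_def)
  show thesis
  proof (rule that[OF e(1)])
    fix f assume "0 \<le> f" "f \<le> e"
    then show "x + f *\<^sub>R d \<in> S \<and> x - f *\<^sub>R d \<in> S"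
      using convex_shorter_step[OF assms(1,2) e(2)] convex_shorter_step[OF assms(1,2) e(3)] e(1)
      by simp
  qed
qed

text \<open>Closure under addition comes from averaging two moves of a common length, which halves
  the step.\<close>

lemma subspace_free_dirs:
  assumes "convex S" "x \<in> S"
  shows "subspace (free_dirs S x)"
proof (rule subspaceI)
  show "0 \<in> free_dirs S x" using assms by (auto simp: free_dirs_def intro!: exI[of _ 1])
next
  fix c d assume "c \<in> free_dirs S x" "d \<in> free_dirs S x"
  from free_dirs_shorter_step[OF assms this(1)] free_dirs_shorter_step[OF assms this(2)]
  obtain e e' where
    e: "e > 0" "\<And>f. 0 \<le> f \<Longrightarrow> f \<le> e \<Longrightarrow> x + f *\<^sub>R c \<in> S \<and> x - f *\<^sub>R c \<in> S" and
    e': "e' > 0" "\<And>f. 0 \<le> f \<Longrightarrow> f \<le> e' \<Longrightarrow> x + f *\<^sub>R d \<in> S \<and> x - f *\<^sub>R d \<in> S"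
    by metis
  define f where "f = min e e'"
  have f: "f > 0" "f \<le> e" "f \<le> e'" using e e' by (auto simp: f_def)
  have half: "(1/2) *\<^sub>R (x + a) + (1/2) *\<^sub>R (x + b) = x + (1/2) *\<^sub>R (a + b)" for a b :: 'a
    by (simp add: algebra_simps flip: scaleR_left.add)
  have "(1/2) *\<^sub>R (x + f *\<^sub>R c) + (1/2) *\<^sub>R (x + f *\<^sub>R d) \<in> S"
    using e e' f by (intro convexD[OF assms(1)]) auto
  moreover have "(1/2) *\<^sub>R (x + - (f *\<^sub>R c)) + (1/2) *\<^sub>R (x + - (f *\<^sub>R d)) \<in> S"
    using e(2)[of f] e'(2)[of f] f by (intro convexD[OF assms(1)]) auto
  ultimately have "x + (f / 2) *\<^sub>R (c + d) \<in> S" "x - (f / 2) *\<^sub>R (c + d) \<in> S"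
    unfolding half by (simp_all add: algebra_simps)
  then show "c + d \<in> free_dirs S x" using f(1) unfolding free_dirs_def by (auto intro!: exI[of _ "f / 2"])
next
  fix c :: real and d assume "d \<in> free_dirs S x"
  then obtain e where e: "e > 0" "x + e *\<^sub>R d \<in> S" "x - e *\<^sub>R d \<in> S" by (auto simp: free_dirs_def)
  show "c *\<^sub>R d \<in> free_dirs S x"
  proof (cases "c = 0")
    case True
    then show ?thesis using assms by (auto simp: free_dirs_def intro!: exI[of _ 1])
  next
    case False
    then have "(e / \<bar>c\<bar>) *\<^sub>R c *\<^sub>R d = e *\<^sub>R d \<or> (e / \<bar>c\<bar>) *\<^sub>R c *\<^sub>R d = - (e *\<^sub>R d)"
      by (cases "c > 0") auto
    then show ?thesis using e False unfolding free_dirs_def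
      by (auto intro!: exI[of _ "e / \<bar>c\<bar>"] simp del: scaleR_scaleR)
  qed
qed

text \<open>The segment from \<open>p\<close> through \<open>x\<close> can be prolonged beyond
  \<open>x\<close> within \<open>S\<close>. A move at \<open>p\<close> is therefore inherited, after
  scaling, by the interior point \<open>x\<close>.\<close>

lemma free_dirs_translate:
  assumes "convex S" "p - x \<in> free_dirs S x" "p + d \<in> S"
  shows "\<exists>e>0. x + e *\<^sub>R d \<in> S"
proof -
  from assms(2) obtain e where e: "e > 0" "x - e *\<^sub>R (p - x) \<in> S" by (auto simp: free_dirs_def)
  \<comment> \<open>This weight places \<open>x\<close> between \<open>p\<close> and the prolonged
    endpoint: the contributions of \<open>p\<close> cancel.\<close>
  define l where "l = e / (1 + e)"
  have l: "l > 0" "l < 1" "(1 - l) * (1 + e) = 1" "(1 - l) * e = l"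
    using e(1) by (auto simp: l_def field_simps)
  have "l *\<^sub>R (p + d) + (1 - l) *\<^sub>R (x - e *\<^sub>R (p - x)) \<in> S"
    using l e by (intro convexD[OF assms(1)] assms(3)) auto
  also have "l *\<^sub>R (p + d) + (1 - l) *\<^sub>R (x - e *\<^sub>R (p - x))
      = l *\<^sub>R d + (l - (1 - l) * e) *\<^sub>R p + ((1 - l) * (1 + e)) *\<^sub>R x"
    by (simp add: algebra_simps)
  also have "\<dots> = x + l *\<^sub>R d" by (simp add: l)
  finally show ?thesis using l by blast
qed

text \<open>The box is filled one coordinate at a time, by averaging its two opposite facets in
  direction \<open>f i\<close>.\<close>

lemma convex_box:
  fixes f :: "'i \<Rightarrow> 'a::real_vector"
  assumes "convex Q" "finite I" "\<And>T. T \<subseteq> I \<Longrightarrow> v + (\<Sum>l\<in>T. f l) \<in> Q"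
    "\<And>l. l \<in> I \<Longrightarrow> 0 \<le> c l \<and> c l \<le> 1"
  shows "v + (\<Sum>l\<in>I. c l *\<^sub>R f l) \<in> Q"
  using assms(2-4)
proof (induction I arbitrary: v)
  case empty
  then show ?case by force
next
  case (insert i I)
  have 1: "v + (\<Sum>l\<in>I. c l *\<^sub>R f l) \<in> Q"
    using insert.prems by (intro insert.IH) auto
  have 2: "(v + f i) + (\<Sum>l\<in>I. c l *\<^sub>R f l) \<in> Q"
  proof (rule insert.IH)
    fix T assume T: "T \<subseteq> I"
    then have "finite T" "i \<notin> T" using insert.hyps finite_subset by auto
    moreover have "v + (\<Sum>l\<in>insert i T. f l) \<in> Q" using T by (intro insert.prems) auto
    ultimately show "v + f i + (\<Sum>l\<in>T. f l) \<in> Q" by (simp add: add.assoc)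
  qed (use insert.prems in auto)
  have "(1 - c i) *\<^sub>R (v + (\<Sum>l\<in>I. c l *\<^sub>R f l)) + c i *\<^sub>R ((v + f i) + (\<Sum>l\<in>I. c l *\<^sub>R f l)) \<in> Q"
    using insert.prems(2)[of i] by (intro convexD[OF assms(1)] 1 2) auto
  then show ?case using insert.hyps by (simp add: algebra_simps)
qed

section \<open>Linearity of matrix products and the embedding of integer vectors\<close>

lemma mat_vec_add: "mat_vec t M (x + y) k = mat_vec t M x k + mat_vec t M y k"
  by (simp add: mat_vec_def sum.distrib algebra_simps)

lemma mat_vec_diff: "mat_vec t M (x - y) k = mat_vec t M x k - mat_vec t M y k"
  by (simp add: mat_vec_def sum_subtractf algebra_simps)

lemma mat_vec_0: "mat_vec t M 0 k = 0"
  by (simp add: mat_vec_def)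

lemma mat_vec_sum: "mat_vec t M (\<Sum>i\<in>I. f i) k = (\<Sum>i\<in>I. mat_vec t M (f i) k)"
  unfolding mat_vec_def sum_fun_apply sum_distrib_left by (rule sum.swap)

lemma mat_vec_scaleR: "mat_vec t M (a *\<^sub>R x) k = a * mat_vec t M x k" for x :: "nat \<Rightarrow> real"
  by (simp add: mat_vec_def sum_distrib_left scaleR_fun_def algebra_simps)

definition real_vec :: "(nat \<Rightarrow> int) \<Rightarrow> nat \<Rightarrow> real"
  where "real_vec u = (\<lambda>j. real_of_int (u j))"

lemma real_vec_apply [simp]: "real_vec u j = real_of_int (u j)"
  by (simp add: real_vec_def)

lemma real_vec_0 [simp]: "real_vec 0 = 0"
  by (simp add: fun_eq_iff)

lemma real_vec_eq_iff [simp]: "real_vec u = real_vec w \<longleftrightarrow> u = w"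
  by (simp add: real_vec_def fun_eq_iff)

lemma real_vec_diff: "real_vec (u - w) = real_vec u - real_vec w"
  by (simp add: fun_eq_iff)

lemma real_vec_sum: "real_vec (\<Sum>i\<in>I. f i) = (\<Sum>i\<in>I. real_vec (f i))"
  by (simp add: fun_eq_iff sum_fun_apply)

lemma mat_vec_real_vec: "mat_vec t M (real_vec u) k = of_int (mat_vec t M u k)"
  by (simp add: mat_vec_def)

lemma abs_mat_vec_le:
  assumes "\<forall>j<t. \<bar>M k j\<bar> \<le> int D" "norm1 t u \<le> int G"
  shows "\<bar>mat_vec t M u k\<bar> \<le> int (D * G)"
proof -
  have "\<bar>mat_vec t M u k\<bar> \<le> (\<Sum>j<t. int D * \<bar>u j\<bar>)"
    unfolding mat_vec_def using assms(1)
    by (intro order.trans[OF sum_abs] sum_mono) (auto simp: abs_mult intro!: mult_right_mono)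
  also have "\<dots> = int D * norm1 t u" by (simp add: norm1_def sum_distrib_left)
  also have "\<dots> \<le> int D * int G" using assms(2) by (intro mult_left_mono) auto
  finally show ?thesis by simp
qed

section \<open>Conformal decomposition into Graver basis elements\<close>

lemma int_kernel_add: "u \<in> int_kernel m t M \<Longrightarrow> w \<in> int_kernel m t M \<Longrightarrow> u + w \<in> int_kernel m t M"
  by (auto simp: int_kernel_def vecs_def mat_vec_add)

lemma int_kernel_0: "0 \<in> int_kernel m t M"
  by (auto simp: int_kernel_def vecs_def mat_vec_0)

lemma int_kernel_sum: "(\<And>i. i \<in> I \<Longrightarrow> f i \<in> int_kernel m t M) \<Longrightarrow> (\<Sum>i\<in>I. f i) \<in> int_kernel m t M"
  by (induction I rule: infinite_finite_induct) (auto simp: int_kernel_add int_kernel_0)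

text \<open>The usual conformal order on integer vectors: same orthant, and no larger in absolute
  value in any coordinate. Where \<open>u j = 0\<close> both clauses apply and force
  \<open>g j = 0\<close>.\<close>

definition conformal :: "(nat \<Rightarrow> int) \<Rightarrow> (nat \<Rightarrow> int) \<Rightarrow> bool"
  where "conformal g u \<longleftrightarrow> (\<forall>j. (0 \<le> u j \<longrightarrow> 0 \<le> g j \<and> g j \<le> u j) \<and> (u j \<le> 0 \<longrightarrow> u j \<le> g j \<and> g j \<le> 0))"

lemma conformal_trans: "conformal g v \<Longrightarrow> conformal v u \<Longrightarrow> conformal g u"
  unfolding conformal_def by (meson linear order.trans)

lemma sign_compatible_conformal: "sign_compatible v w \<Longrightarrow> conformal v (v + w)"
proof -
  assume "sign_compatible v w"
  then have "v j * w j \<ge> 0" for j by (auto simp: sign_compatible_def)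
  then have "(0 \<le> v j \<and> 0 \<le> w j) \<or> (v j \<le> 0 \<and> w j \<le> 0)" for j
    by (metis linear zero_le_mult_iff mult_nonneg_nonpos order_antisym)
  then show ?thesis unfolding conformal_def plus_fun_apply by (smt (verit))
qed

lemma sign_compatible_commute: "sign_compatible v w \<Longrightarrow> sign_compatible w v"
  by (simp add: sign_compatible_def mult.commute)

lemma norm1_conformal_add: "conformal v (v + w) \<Longrightarrow> norm1 t (v + w) = norm1 t v + norm1 t w"
  unfolding norm1_def sum.distrib[symmetric] conformal_def plus_fun_apply
  by (intro sum.cong) (auto, smt (verit))

lemma norm1_pos:
  fixes u :: "nat \<Rightarrow> 'a::linordered_idom"
  assumes "u \<in> vecs t" "u \<noteq> 0"
  shows "norm1 t u > 0"
proof -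
  from assms obtain j where "u j \<noteq> 0" "j < t" by (auto simp: vecs_def fun_eq_iff) (metis not_le)
  then show ?thesis unfolding norm1_def by (intro sum_pos2[of _ j]) auto
qed

lemma graver_basis_int_kernel: "g \<in> graver_basis m t M \<Longrightarrow> g \<in> int_kernel m t M \<and> g \<noteq> 0"
  by (auto simp: graver_basis_def)

text \<open>A nonzero kernel vector outside the Graver basis splits into two nonzero sign-compatible
  parts. Their l1-norms add up, so both are shorter and the recursion ends.\<close>

lemma graver_decomposition_list:
  assumes "u \<in> int_kernel m t M"
  shows "\<exists>gs. sum_list gs = u \<and> (\<forall>g\<in>set gs. g \<in> graver_basis m t M \<and> conformal g u)"
  using assms
proof (induction "nat (norm1 t u)" arbitrary: u rule: less_induct)
  case less
  consider "u = 0" | "u \<in> graver_basis m t M" | "u \<noteq> 0" "u \<notin> graver_basis m t M" by blast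
  then show ?case
  proof cases
    case 1
    then show ?thesis by (intro exI[of _ "[]"]) auto
  next
    case 2
    then show ?thesis by (intro exI[of _ "[u]"]) (auto simp: conformal_def)
  next
    case 3
    with less.prems obtain v w where vw: "v \<in> int_kernel m t M" "v \<noteq> 0" "w \<in> int_kernel m t M" "w \<noteq> 0"
      "sign_compatible v w" "u = v + w" by (auto simp: graver_basis_def)
    have conf: "conformal v u" "conformal w u"
      using sign_compatible_conformal[OF vw(5)] sign_compatible_conformal[OF sign_compatible_commute[OF vw(5)]]
      by (simp_all add: vw(6) add.commute)
    have "norm1 t u = norm1 t v + norm1 t w" using conf(1) unfolding vw(6) by (rule norm1_conformal_add)
    moreover have "norm1 t v > 0" "norm1 t w > 0" using vw by (auto intro!: norm1_pos simp: int_kernel_def)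
    ultimately have "nat (norm1 t v) < nat (norm1 t u)" "nat (norm1 t w) < nat (norm1 t u)" by auto
    from less.hyps[OF this(1) vw(1)] less.hyps[OF this(2) vw(3)] obtain gs hs where
      gs: "sum_list gs = v" "\<forall>g\<in>set gs. g \<in> graver_basis m t M \<and> conformal g v" and
      hs: "sum_list hs = w" "\<forall>g\<in>set hs. g \<in> graver_basis m t M \<and> conformal g w" by blast
    moreover have "conformal g u" if "g \<in> set (gs @ hs)" for g
      using that gs(2) hs(2) conf conformal_trans by auto
    ultimately show ?thesis using vw(6)
      by (intro exI[of _ "gs @ hs"]) (simp del: set_append, auto)
  qed
qed

lemma graver_decomposition:
  assumes "u \<in> int_kernel m t M"
  obtains N :: nat and h where "u = (\<Sum>l<N. h l)" "\<And>l. l < N \<Longrightarrow> h l \<in> graver_basis m t M \<and> conformal (h l) u"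
proof -
  from graver_decomposition_list[OF assms] obtain gs where
    "sum_list gs = u" "\<forall>g\<in>set gs. g \<in> graver_basis m t M \<and> conformal g u" by blast
  then show thesis by (intro that[of "(!) gs" "length gs"]) (auto simp: sum_list_sum_nth atLeast0LessThan)
qed

text \<open>All summands lie in the orthant of \<open>u\<close>, so nothing cancels and omitting
  some of them only moves each coordinate towards zero.\<close>

lemma conformal_sum_subset:
  assumes "u = (\<Sum>l\<in>I. h l)" "finite I" "\<And>l. l \<in> I \<Longrightarrow> conformal (h l) u" "J \<subseteq> I"
  shows "conformal (\<Sum>l\<in>J. h l) u"
  unfolding conformal_def
proof (intro allI conjI impI)
  fix j
  have u: "u j = (\<Sum>l\<in>I. h l j)" by (subst assms(1)) (simp add: sum_fun_apply)
  have split: "(\<Sum>l\<in>I. h l j) = (\<Sum>l\<in>J. h l j) + (\<Sum>l\<in>I-J. h l j)"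
    using assms(2,4) by (metis add.commute sum.subset_diff)
  {
    assume "0 \<le> u j"
    then have pos: "\<And>l. l \<in> I \<Longrightarrow> 0 \<le> h l j" using assms(3) by (auto simp: conformal_def)
    then have "0 \<le> (\<Sum>l\<in>J. h l j)" "0 \<le> (\<Sum>l\<in>I-J. h l j)" using assms(4) by (auto intro!: sum_nonneg)
    then show "0 \<le> (\<Sum>l\<in>J. h l) j" "(\<Sum>l\<in>J. h l) j \<le> u j" using u split by (auto simp: sum_fun_apply)
  }
  {
    assume "u j \<le> 0"
    then have neg: "\<And>l. l \<in> I \<Longrightarrow> h l j \<le> 0" using assms(3) by (auto simp: conformal_def)
    then have "(\<Sum>l\<in>J. h l j) \<le> 0" "(\<Sum>l\<in>I-J. h l j) \<le> 0" using assms(4) by (auto intro!: sum_nonpos)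
    then show "u j \<le> (\<Sum>l\<in>J. h l) j" "(\<Sum>l\<in>J. h l) j \<le> 0" using u split by (auto simp: sum_fun_apply)
  }
qed

section \<open>Exchanges between integer points\<close>

lemma integer_points_diff:
  assumes "p \<in> integer_points m t B b" "q \<in> integer_points m t B b"
  obtains u where "u \<in> int_kernel m t B" "q - p = real_vec u"
proof
  define u where "u j = \<lfloor>q j - p j\<rfloor>" for j
  have "q j - p j \<in> \<int>" for j
    using assms by (cases "j < t") (auto simp: integer_points_def vecs_def)
  then show eq: "q - p = real_vec u" by (auto simp: fun_eq_iff u_def elim!: Ints_cases)
  have "real_of_int (mat_vec t B u k) = 0" if "k < m" for k
    unfolding mat_vec_real_vec[symmetric] eq[symmetric] mat_vec_diff
    using assms that by (auto simp: integer_points_def)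
  then show "u \<in> int_kernel m t B"
    using assms by (auto simp: int_kernel_def integer_points_def vecs_def u_def)
qed

text \<open>Conformality keeps each coordinate of both new points between the coordinates of
  \<open>p\<close> and \<open>q\<close>, hence nonnegative.\<close>

lemma integer_points_exchange:
  assumes "p \<in> integer_points m t B b" "q \<in> integer_points m t B b" "q - p = real_vec u"
    "g \<in> int_kernel m t B" "conformal g u"
  shows "p + real_vec g \<in> integer_points m t B b \<and> q - real_vec g \<in> integer_points m t B b"
proof -
  have ker: "mat_vec t B (real_vec g) k = 0" if "k < m" for k
    using assms(4) that by (simp add: int_kernel_def mat_vec_real_vec)
  have "0 \<le> p j + g j \<and> 0 \<le> q j - g j" if "j < t" for j
  proof -
    have "q j - p j = u j" using fun_cong[OF assms(3), of j] by simp
    moreover have "0 \<le> p j" "0 \<le> q j" using assms(1,2) that by (auto simp: integer_points_def)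
    moreover have "(0 \<le> real_of_int (g j) \<and> real_of_int (g j) \<le> u j) \<or>
        (u j \<le> real_of_int (g j) \<and> real_of_int (g j) \<le> 0)"
      using assms(5) unfolding conformal_def by (metis linear of_int_0_le_iff of_int_le_0_iff of_int_le_iff)
    ultimately show ?thesis by linarith
  qed
  then show ?thesis using assms(1,2,4) ker
    by (auto simp: integer_points_def int_kernel_def vecs_def mat_vec_add mat_vec_diff)
qed

text \<open>The hull stays inside the real relaxation of the system, whose integral points are
  exactly the given ones.\<close>

lemma integer_points_hull:
  assumes "y \<in> convex hull integer_points m t B b" "\<forall>j<t. y j \<in> \<int>"
  shows "y \<in> integer_points m t B b"
proof -
  let ?P = "{x \<in> vecs t. (\<forall>j<t. x j \<ge> 0) \<and> (\<forall>k<m. mat_vec t B x k = real_of_int (b k))}"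
  have "convex ?P"
  proof (rule convexI)
    fix x y :: "nat \<Rightarrow> real" and u v :: real
    assume "x \<in> ?P" "y \<in> ?P" "0 \<le> u" "0 \<le> v" "u + v = 1"
    then show "u *\<^sub>R x + v *\<^sub>R y \<in> ?P"
      by (auto simp: vecs_def mat_vec_add mat_vec_scaleR distrib_right[symmetric])
        (auto simp: scaleR_fun_def)
  qed
  then have "convex hull integer_points m t B b \<subseteq> ?P"
    by (intro hull_minimal) (auto simp: integer_points_def)
  with assms show ?thesis by (auto simp: integer_points_def)
qed

section \<open>Integral rounding within the minimal face\<close>

lemma sum_by_value:
  fixes F :: "'a \<Rightarrow> 'b::real_vector" and N :: nat
  assumes "finite P" "h ` {..<N} \<subseteq> P"
  shows "(\<Sum>l<N. F (h l)) = (\<Sum>g\<in>P. real (card {l. l < N \<and> h l = g}) *\<^sub>R F g)"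
proof -
  have "(\<Sum>l<N. F (h l)) = (\<Sum>g\<in>P. \<Sum>l\<in>{l \<in> {..<N}. h l = g}. F (h l))"
    using assms by (intro sum.group[symmetric] finite_lessThan) auto
  also have "\<dots> = (\<Sum>g\<in>P. real (card {l. l < N \<and> h l = g}) *\<^sub>R F g)"
    by (intro sum.cong) (simp_all add: sum_constant_scaleR)
  finally show ?thesis .
qed

text \<open>Write \<open>x\<close> as a convex combination of integer points, fix one of them,
  \<open>v\<close>, and decompose every \<open>p - v\<close> conformally. Collecting equal Graver
  elements gives \<open>x\<close> as \<open>v\<close> plus multiples \<open>\<mu> g\<close>;
  rounding these down yields \<open>y\<close>, and the fractional parts are the coefficients
  \<open>c\<close>.\<close>

lemma integral_rounding:
  assumes Q: "Q = convex hull integer_points m t B b" and x: "x \<in> Q"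
  shows "\<exists>y P c. y \<in> integer_points m t B b \<and> y - x \<in> free_dirs Q x \<and> finite P \<and>
    (\<forall>g\<in>P. g \<in> graver_basis m t B \<and> real_vec g \<in> free_dirs Q x \<and> 0 \<le> c g \<and> c g \<le> 1) \<and>
    x - y = (\<Sum>g\<in>P. c g *\<^sub>R real_vec g)"
proof -
  let ?IP = "integer_points m t B b"
  have conv: "convex Q" and sub: "?IP \<subseteq> Q" unfolding Q by (auto simp: convex_convex_hull hull_subset)
  note L = subspace_free_dirs[OF conv x]
  obtain s w where s: "finite s" "s \<subseteq> ?IP" "\<forall>p\<in>s. 0 \<le> w p" "sum w s = 1" "(\<Sum>p\<in>s. w p *\<^sub>R p) = x"
    using x unfolding Q convex_hull_explicit by blast
  \<comment> \<open>Only points of positive weight are kept, since these lie in the minimal face of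
    \<open>x\<close>.\<close>
  define S where "S = {p\<in>s. w p > 0}"
  have S: "finite S" "S \<subseteq> ?IP" "\<And>p. p \<in> S \<Longrightarrow> 0 < w p" using s by (auto simp: S_def)
  have "sum w S = sum w s" "(\<Sum>p\<in>S. w p *\<^sub>R p) = (\<Sum>p\<in>s. w p *\<^sub>R p)"
    unfolding S_def using s(1,3) by (auto intro!: sum.mono_neutral_left)
  then have S': "sum w S = 1" "x = (\<Sum>p\<in>S. w p *\<^sub>R p)" using s by auto
  have supp: "p - x \<in> free_dirs Q x" if p: "p \<in> S" for p
  proof -
    define e where "e = w p"
    have "e \<le> 1" using sum_mono2[OF S(1), of "{p}" w] p S S' by (auto simp: e_def less_imp_le)
    moreover have "e > 0" using S p by (auto simp: e_def)
    ultimately have "(1 - e) *\<^sub>R x + e *\<^sub>R p \<in> Q" using S(2) sub p x by (intro convexD[OF conv]) auto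
    then have 1: "x + e *\<^sub>R (p - x) \<in> Q" by (simp add: algebra_simps)
    \<comment> \<open>Convex weights for \<open>x - e *\<^sub>R (p - x)\<close>; at \<open>p\<close>
      the weight is \<open>e * e\<close>.\<close>
    define w' where "w' q = (1 + e) * w q - (if q = p then e else 0)" for q
    have "(\<Sum>q\<in>S. w' q *\<^sub>R q) \<in> Q"
    proof (rule convex_sum[OF S(1) conv])
      show "sum w' S = 1" using S'(1) S(1) p
        by (simp add: w'_def sum_subtractf sum_distrib_left[symmetric])
      show "0 \<le> w' q" if "q \<in> S" for q
        using \<open>e > 0\<close> S(3)[OF that] by (auto simp: w'_def e_def algebra_simps)
      show "q \<in> Q" if "q \<in> S" for q using that S(2) sub by auto
    qed
    also have "(\<Sum>q\<in>S. w' q *\<^sub>R q) = (\<Sum>q\<in>S. (1 + e) *\<^sub>R w q *\<^sub>R q - (if q = p then e *\<^sub>R p else 0))"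
      by (intro sum.cong) (auto simp: w'_def algebra_simps)
    also have "\<dots> = (1 + e) *\<^sub>R x - e *\<^sub>R p"
      unfolding sum_subtractf scaleR_sum_right[symmetric] S'(2)[symmetric] using S(1) p by simp
    also have "\<dots> = x - e *\<^sub>R (p - x)" by (simp add: algebra_simps)
    finally show ?thesis using 1 \<open>e > 0\<close> unfolding free_dirs_def mem_Collect_eq by blast
  qed
  have "S \<noteq> {}" using S'(1) by auto
  then obtain v where v: "v \<in> S" by auto
  define decomposes where "decomposes p N h u \<longleftrightarrow> p - v = real_vec u \<and> u = (\<Sum>l<N. h l) \<and>
      (\<forall>l<N. h l \<in> graver_basis m t B \<and> conformal (h l) u)" for p u h and N :: nat
  have "\<exists>N h u. decomposes p N h u" if "p \<in> S" for p
  proof -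
    from integer_points_diff[of v m t B b p] S(2) v that obtain u where
      u: "u \<in> int_kernel m t B" "p - v = real_vec u" by blast
    obtain N :: nat and h where "u = (\<Sum>l<N. h l)"
        "\<And>l. l < N \<Longrightarrow> h l \<in> graver_basis m t B \<and> conformal (h l) u"
      by (rule graver_decomposition[OF u(1)]) (rule that)
    with u(2) show ?thesis unfolding decomposes_def by blast
  qed
  then obtain N h u where dec': "\<And>p. p \<in> S \<Longrightarrow> decomposes p (N p) (h p) (u p)" by metis
  have dec: "p - v = real_vec (u p)" "u p = (\<Sum>l<N p. h p l)"
      "l < N p \<Longrightarrow> h p l \<in> graver_basis m t B \<and> conformal (h p l) (u p)" if "p \<in> S" for p l
    using dec'[OF that] unfolding decomposes_def by blast+
  define P where "P = (\<Union>p\<in>S. h p ` {..<N p})"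
  have P: "finite P" "\<And>p. p \<in> S \<Longrightarrow> h p ` {..<N p} \<subseteq> P" using S(1) by (auto simp: P_def)
  have sub_sum: "v + real_vec (\<Sum>l\<in>T. h p l) \<in> ?IP \<and> p - real_vec (\<Sum>l\<in>T. h p l) \<in> ?IP"
    if "p \<in> S" "T \<subseteq> {..<N p}" for p T
  proof (rule integer_points_exchange[OF _ _ dec(1)[OF that(1)]])
    show "(\<Sum>l\<in>T. h p l) \<in> int_kernel m t B"
      using dec(3)[OF that(1)] that(2) by (intro int_kernel_sum) (auto simp: graver_basis_def)
    show "conformal (\<Sum>l\<in>T. h p l) (u p)"
      using dec(3)[OF that(1)] that(2) by (intro conformal_sum_subset[OF dec(2)[OF that(1)]]) auto
  qed (use v that S(2) in auto)
  \<comment> \<open>The element can be added at \<open>v\<close> and subtracted at \<open>p\<close>.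
    Both points lie in the minimal face, so both moves transfer to \<open>x\<close>.\<close>
  have P_props: "g \<in> graver_basis m t B \<and> real_vec g \<in> free_dirs Q x" if "g \<in> P" for g
  proof -
    from that obtain p l where pl: "p \<in> S" "l < N p" "g = h p l" by (auto simp: P_def)
    have "v + real_vec g \<in> Q" "p + - real_vec g \<in> Q"
      using sub_sum[OF pl(1), of "{l}"] pl(2,3) sub by auto
    from free_dirs_translate[OF conv supp[OF v] this(1)] free_dirs_translate[OF conv supp[OF pl(1)] this(2)]
    obtain e e' where e: "e > 0" "x + e *\<^sub>R real_vec g \<in> Q" "e' > 0" "x + e' *\<^sub>R (- real_vec g) \<in> Q" by blast
    have "x + min e e' *\<^sub>R real_vec g \<in> Q" "x + min e e' *\<^sub>R (- real_vec g) \<in> Q"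
      using convex_shorter_step[OF conv x e(2), of "min e e'"] convex_shorter_step[OF conv x e(4), of "min e e'"] e
      by auto
    then have "real_vec g \<in> free_dirs Q x" using e unfolding free_dirs_def
      by (auto intro!: exI[of _ "min e e'"])
    with dec(3)[OF pl(1,2)] pl(3) show ?thesis by auto
  qed
  \<comment> \<open>\<open>c p g\<close> is the multiplicity of \<open>g\<close> in the
    decomposition of \<open>p - v\<close>, and \<open>\<mu> g\<close> its weighted average over
    \<open>S\<close>.\<close>
  define c where "c p g = real (card {l. l < N p \<and> h p l = g})" for p g
  define \<mu> where "\<mu> g = (\<Sum>p\<in>S. w p * c p g)" for g
  have combine: "(\<Sum>p\<in>S. w p *\<^sub>R (v + (\<Sum>l<N p. f (h p l) *\<^sub>R real_vec (h p l))))
      = v + (\<Sum>g\<in>P. (\<mu> g * f g) *\<^sub>R real_vec g)" for f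
  proof -
    have "(\<Sum>p\<in>S. w p *\<^sub>R (v + (\<Sum>l<N p. f (h p l) *\<^sub>R real_vec (h p l))))
        = (\<Sum>p\<in>S. w p *\<^sub>R v + (\<Sum>g\<in>P. (w p * c p g * f g) *\<^sub>R real_vec g))"
      using sum_by_value[OF P(1) P(2), of _ "\<lambda>g. f g *\<^sub>R real_vec g"]
      by (intro sum.cong) (simp_all add: c_def scaleR_add_right scaleR_sum_right mult.assoc)
    also have "\<dots> = sum w S *\<^sub>R v + (\<Sum>g\<in>P. \<Sum>p\<in>S. (w p * c p g * f g) *\<^sub>R real_vec g)"
      unfolding sum.distrib scaleR_sum_left by (subst sum.swap) (rule refl)
    also have "\<dots> = v + (\<Sum>g\<in>P. (\<mu> g * f g) *\<^sub>R real_vec g)"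
      by (simp add: S'(1) \<mu>_def sum_distrib_right scaleR_sum_left)
    finally show ?thesis .
  qed
  have x_eq: "x = v + (\<Sum>g\<in>P. \<mu> g *\<^sub>R real_vec g)"
  proof -
    have "x = (\<Sum>p\<in>S. w p *\<^sub>R (v + (\<Sum>l<N p. 1 *\<^sub>R real_vec (h p l))))"
      unfolding S'(2)
    proof (intro sum.cong refl)
      fix p assume p: "p \<in> S"
      have "p = v + real_vec (u p)" using dec(1)[OF p] by (metis add.commute diff_add_cancel)
      also have "real_vec (u p) = (\<Sum>l<N p. real_vec (h p l))"
        using dec(2)[OF p] by (simp add: real_vec_sum)
      finally show "w p *\<^sub>R p = w p *\<^sub>R (v + (\<Sum>l<N p. 1 *\<^sub>R real_vec (h p l)))"
        unfolding scaleR_one by (rule arg_cong)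
    qed
    then show ?thesis using combine[of "\<lambda>_. 1"] by simp
  qed
  have \<mu>0: "\<mu> g \<ge> 0" for g using S(3) by (auto simp: \<mu>_def c_def less_imp_le intro!: sum_nonneg)
  \<comment> \<open>The scaling that turns \<open>\<mu> g\<close> into its floor. If
    \<open>\<mu> g = 0\<close>, division by zero gives 0, which is the value wanted.\<close>
  define \<theta> where "\<theta> g = of_int \<lfloor>\<mu> g\<rfloor> / \<mu> g" for g
  have \<theta>: "0 \<le> \<theta> g \<and> \<theta> g \<le> 1" "\<mu> g * \<theta> g = of_int \<lfloor>\<mu> g\<rfloor>" for g
    using \<mu>0[of g] by (auto simp: \<theta>_def divide_le_eq_1)
  define y where "y = v + (\<Sum>g\<in>P. real_of_int \<lfloor>\<mu> g\<rfloor> *\<^sub>R real_vec g)"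
  \<comment> \<open>For each \<open>p\<close> all partial sums from \<open>v\<close> stay in
    \<open>Q\<close>, so \<open>convex_box\<close> allows scaling by \<open>\<theta>\<close>;
    averaging over \<open>S\<close> then gives \<open>y\<close>.\<close>
  have "(\<Sum>p\<in>S. w p *\<^sub>R (v + (\<Sum>l<N p. \<theta> (h p l) *\<^sub>R real_vec (h p l)))) \<in> Q"
  proof (rule convex_sum[OF S(1) conv S'(1)])
    fix p assume p: "p \<in> S"
    show "v + (\<Sum>l<N p. \<theta> (h p l) *\<^sub>R real_vec (h p l)) \<in> Q"
    proof (rule convex_box[OF conv])
      fix T assume "T \<subseteq> {..<N p}"
      from sub_sum[OF p this] show "v + (\<Sum>l\<in>T. real_vec (h p l)) \<in> Q"
        using sub by (auto simp: real_vec_sum)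
    qed (use \<theta> in auto)
  qed (use S(3) less_imp_le in auto)
  then have "y \<in> Q" unfolding combine by (simp add: y_def \<theta>)
  moreover have "y j \<in> \<int>" if "j < t" for j
    using v S(2) that
    by (auto simp: y_def sum_fun_apply scaleR_fun_def integer_points_def intro!: Ints_add Ints_sum)
  ultimately have "y \<in> ?IP" unfolding Q by (intro integer_points_hull) auto
  moreover have "y - x \<in> free_dirs Q x"
  proof -
    have "y - x = (v - x) + (\<Sum>g\<in>P. real_of_int \<lfloor>\<mu> g\<rfloor> *\<^sub>R real_vec g)" by (simp add: y_def)
    also have "\<dots> \<in> free_dirs Q x"
      using P_props supp[OF v] by (intro subspace_add[OF L] subspace_sum[OF L] subspace_scale[OF L]) auto
    finally show ?thesis .
  qed
  moreover have "x - y = (\<Sum>g\<in>P. frac (\<mu> g) *\<^sub>R real_vec g)"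
    unfolding y_def by (subst x_eq) (simp add: frac_def scaleR_diff_left sum_subtractf)
  ultimately show ?thesis using P(1) P_props
    by (intro exI[of _ y] exI[of _ P] exI[of _ "\<lambda>g. frac (\<mu> g)"]) (auto simp: less_imp_le[OF frac_lt_1])
qed

subsection \<open>Proximity\<close>

lemma norm1_conformal_sum:
  assumes "\<And>l. l \<in> J \<Longrightarrow> conformal (h l) u"
  shows "norm1 t (\<Sum>l\<in>J. h l) = (\<Sum>l\<in>J. norm1 t (h l))"
proof -
  have "\<bar>\<Sum>l\<in>J. h l j\<bar> = (\<Sum>l\<in>J. \<bar>h l j\<bar>)" for j
  proof (cases "u j \<ge> 0")
    case True
    then have "\<And>l. l \<in> J \<Longrightarrow> 0 \<le> h l j" using assms by (auto simp: conformal_def)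
    then show ?thesis by (simp add: sum_nonneg)
  next
    case False
    then have "\<And>l. l \<in> J \<Longrightarrow> h l j \<le> 0" using assms by (auto simp: conformal_def)
    then show ?thesis by (simp add: sum_nonpos sum_negf[symmetric])
  qed
  then have "norm1 t (\<Sum>l\<in>J. h l) = (\<Sum>j<t. \<Sum>l\<in>J. \<bar>h l j\<bar>)"
    by (simp add: norm1_def sum_fun_apply)
  then show ?thesis unfolding norm1_def by (simp add: sum.swap[of _ J])
qed

lemma norm1_real_vec: "norm1 t (real_vec u) = of_int (norm1 t u)"
  by (simp add: norm1_def)

lemma norm1_triangle: "norm1 t (x + y) \<le> norm1 t x + norm1 t y"
  unfolding norm1_def plus_fun_apply sum.distrib[symmetric] by (intro sum_mono abs_triangle_ineq)

lemma norm1_sum_le: "norm1 t (\<Sum>i\<in>I. f i) \<le> (\<Sum>i\<in>I. norm1 t (f i))"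
proof -
  have "norm1 t (\<Sum>i\<in>I. f i) \<le> (\<Sum>j<t. \<Sum>i\<in>I. \<bar>f i j\<bar>)"
    unfolding norm1_def sum_fun_apply by (intro sum_mono sum_abs)
  then show ?thesis unfolding norm1_def by (simp add: sum.swap[of _ I])
qed

lemma norm1_scaleR: "norm1 t (a *\<^sub>R x) = \<bar>a\<bar> * norm1 t x" for x :: "nat \<Rightarrow> real"
  by (simp add: norm1_def scaleR_fun_def abs_mult sum_distrib_left)

lemma norm1_nonneg: "norm1 t x \<ge> 0"
  by (simp add: norm1_def sum_nonneg)

lemma block_norm1_triangle: "block_norm1 n t (x + y) \<le> block_norm1 n t x + block_norm1 n t y"
  unfolding block_norm1_def plus_fun_apply[of x y] sum.distrib[symmetric]
  by (intro sum_mono norm1_triangle)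

lemma block_norm1_integral:
  assumes "\<And>i. i < n \<Longrightarrow> y i = real_vec (w i)"
  shows "block_norm1 n t y = of_int (\<Sum>i<n. norm1 (t i) (w i))"
  using assms by (simp add: block_norm1_def norm1_real_vec)

lemma block_objective_add: "block_objective n t c (y + d) = block_objective n t c y + block_objective n t c d"
  by (simp add: block_objective_def sum.distrib distrib_left)

lemma block_objective_scaleR: "block_objective n t c (e *\<^sub>R d) = e * block_objective n t c d"
  by (simp add: block_objective_def scaleR_fun_def sum_distrib_left algebra_simps)

definition single_block :: "nat \<Rightarrow> 'a::zero \<Rightarrow> nat \<Rightarrow> 'a"
  where "single_block i d = (\<lambda>i'. if i' = i then d else 0)"

lemma single_block_apply [simp]: "single_block i d i' = (if i' = i then d else 0)"
  by (simp add: single_block_def)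

section \<open>The block program at a vertex\<close>

locale block_lp =
  fixes n r :: nat and t s :: "nat \<Rightarrow> nat" and A B :: "nat \<Rightarrow> nat \<Rightarrow> nat \<Rightarrow> int"
    and b\<^sub>0 :: "nat \<Rightarrow> int" and b :: "nat \<Rightarrow> nat \<Rightarrow> int" and Q :: "nat \<Rightarrow> (nat \<Rightarrow> real) set"
    and D G :: nat and x :: "nat \<Rightarrow> nat \<Rightarrow> real"
  assumes Q_eq: "i < n \<Longrightarrow> Q i = convex hull integer_points (s i) (t i) (B i) (b i)"
    and graver_norm: "i < n \<Longrightarrow> u \<in> graver_basis (s i) (t i) (B i) \<Longrightarrow> norm1 (t i) u \<le> int G"
    and A_bound: "i < n \<Longrightarrow> k < r \<Longrightarrow> j < t i \<Longrightarrow> \<bar>A i k j\<bar> \<le> int D"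
    and extreme: "x extreme_point_of lp_feasible n r t A b\<^sub>0 Q"
begin

text \<open>The linking constraints are left out so that free directions refer to the product of the
  \<open>Q i\<close>, where the vertex \<open>x\<close> may lie inside a face of positive
  dimension.\<close>

definition region :: "(nat \<Rightarrow> nat \<Rightarrow> real) set"
  where "region = {y \<in> vecs n. \<forall>i<n. y i \<in> Q i}"

definition linking :: "(nat \<Rightarrow> nat \<Rightarrow> real) \<Rightarrow> nat \<Rightarrow> real"
  where "linking y k = (\<Sum>i<n. mat_vec (t i) (A i) (y i) k)"

lemma lp_feasible_iff: "y \<in> lp_feasible n r t A b\<^sub>0 Q \<longleftrightarrow> y \<in> region \<and> (\<forall>k<r. linking y k = b\<^sub>0 k)"
  by (auto simp: lp_feasible_def region_def linking_def)

lemma ip_feasible_iff: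
  "y \<in> ip_feasible n r t A b\<^sub>0 Q \<longleftrightarrow> y \<in> vecs n \<and>
    (\<forall>i<n. y i \<in> integer_points (s i) (t i) (B i) (b i)) \<and> (\<forall>k<r. linking y k = b\<^sub>0 k)"
proof -
  have "y i \<in> Q i \<and> (\<forall>j<t i. y i j \<in> \<int>) \<longleftrightarrow> y i \<in> integer_points (s i) (t i) (B i) (b i)" if "i < n" for i
    unfolding Q_eq[OF that]
    using integer_points_hull[of "y i"] hull_subset[of "integer_points (s i) (t i) (B i) (b i)" convex]
    by (auto simp: integer_points_def)
  then show ?thesis
    by (auto simp: ip_feasible_def lp_feasible_def linking_def)
qed

text \<open>The threshold of \<open>zero_sum_subfamily\<close> for \<open>K = D * G\<close> and
  \<open>M = (2 * (D * G) + 1) ^ r\<close>.\<close>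

definition piece_bound :: nat
  where "piece_bound = ((2 * (D * G) + 1) ^ r + 1) * (4 * (D * G) * r + 2 * (D * G) + 2) ^ r"

lemma x_region: "x \<in> region" and x_linking: "k < r \<Longrightarrow> linking x k = b\<^sub>0 k"
  using extreme by (auto simp: extreme_point_of_def lp_feasible_iff)

lemma linking_add: "linking (y + d) k = linking y k + linking d k"
  by (simp add: linking_def mat_vec_add sum.distrib)

lemma linking_diff: "linking (y - d) k = linking y k - linking d k"
  by (simp add: linking_def mat_vec_diff sum_subtractf)

lemma linking_scaleR: "linking (e *\<^sub>R d) k = e * linking d k"
proof -
  have "(e *\<^sub>R d) i = e *\<^sub>R d i" for i by (simp add: scaleR_fun_def)
  then show ?thesis by (simp add: linking_def mat_vec_scaleR sum_distrib_left)
qed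

lemma linking_single_block: "i < n \<Longrightarrow> linking (single_block i d) k = mat_vec (t i) (A i) d k"
  unfolding linking_def by (subst sum.remove[of _ i]) (auto simp: mat_vec_0)

lemma convex_Q: "i < n \<Longrightarrow> convex (Q i)"
  by (simp add: Q_eq convex_convex_hull)

lemma convex_region: "convex region"
proof (rule convexI)
  fix y z :: "nat \<Rightarrow> nat \<Rightarrow> real" and u v :: real
  assume *: "y \<in> region" "z \<in> region" "0 \<le> u" "0 \<le> v" "u + v = 1"
  have "(u *\<^sub>R y + v *\<^sub>R z) i = u *\<^sub>R y i + v *\<^sub>R z i" for i by (simp add: scaleR_fun_def)
  then show "u *\<^sub>R y + v *\<^sub>R z \<in> region"
    using * by (auto simp: region_def vecs_def intro!: convexD[OF convex_Q])
qed

lemmas subspace_dirs = subspace_free_dirs[OF convex_region x_region]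

text \<open>Otherwise \<open>x\<close> would be the midpoint of a proper segment of feasible points,
  against extremality. So the linking map is injective on free directions.\<close>

lemma free_dirs_linking_eq_0:
  assumes "d \<in> free_dirs region x" "\<And>k. k < r \<Longrightarrow> linking d k = 0"
  shows "d = 0"
proof (rule ccontr)
  assume "d \<noteq> 0"
  from assms(1) obtain e where e: "e > 0" "x + e *\<^sub>R d \<in> region" "x - e *\<^sub>R d \<in> region"
    unfolding free_dirs_def by blast
  let ?p = "x + e *\<^sub>R d" and ?q = "x - e *\<^sub>R d"
  have "?p \<in> lp_feasible n r t A b\<^sub>0 Q" "?q \<in> lp_feasible n r t A b\<^sub>0 Q"
    unfolding lp_feasible_iff linking_add linking_diff linking_scaleR
    using e assms(2) x_linking by auto
  moreover have "?p \<noteq> ?q"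
  proof
    assume "?p = ?q"
    have "(e + e) *\<^sub>R d = ?p - ?q" unfolding scaleR_left.add by simp
    with \<open>?p = ?q\<close> have "(e + e) *\<^sub>R d = 0" by simp
    then show False using e(1) \<open>d \<noteq> 0\<close> unfolding scaleR_eq_0_iff by simp
  qed
  moreover have "x = (1 - 1/2) *\<^sub>R ?p + (1/2) *\<^sub>R ?q"
    by (simp add: algebra_simps flip: scaleR_left.add)
  then have "?p \<noteq> ?q \<Longrightarrow> x \<in> open_segment ?p ?q"
    unfolding in_segment by (intro conjI exI[of _ "1/2"]) auto
  ultimately show False using extreme unfolding extreme_point_of_def by blast
qed

lemma single_block_free_dirs:
  assumes "i < n" "d \<in> free_dirs (Q i) (x i)"
  shows "single_block i d \<in> free_dirs region x"
proof -
  from assms(2) obtain e where e: "e > 0" "x i + e *\<^sub>R d \<in> Q i" "x i - e *\<^sub>R d \<in> Q i"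
    unfolding free_dirs_def by blast
  have "x + e *\<^sub>R single_block i d = x(i := x i + e *\<^sub>R d)"
    "x - e *\<^sub>R single_block i d = x(i := x i - e *\<^sub>R d)"
    by (auto simp: scaleR_fun_def fun_eq_iff)
  moreover have "x(i := y) \<in> region" if "y \<in> Q i" for y
    using x_region that assms(1) unfolding region_def vecs_def by auto
  ultimately have "x + e *\<^sub>R single_block i d \<in> region" "x - e *\<^sub>R single_block i d \<in> region"
    using e by auto
  with e(1) show ?thesis unfolding free_dirs_def by blast
qed

lemma blockwise_free_dirs:
  assumes "y \<in> vecs n" "\<And>i. i < n \<Longrightarrow> y i \<in> free_dirs (Q i) (x i)"
  shows "y \<in> free_dirs region x"
proof -
  have "(\<Sum>i<n. single_block i (y i)) i' = y i'" for i'
    using assms(1) by (simp add: sum_fun_apply vecs_def)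
  then have "y = (\<Sum>i<n. single_block i (y i))" by (intro ext) simp
  also have "\<dots> \<in> free_dirs region x"
    using assms(2) by (intro subspace_sum[OF subspace_dirs] single_block_free_dirs) auto
  finally show ?thesis .
qed

text \<open>The difference of the two single-block directions has linking image zero and therefore
  vanishes; distinct blocks would force \<open>g = 0\<close>.\<close>

lemma free_pair_unique:
  assumes "i < n" "real_vec g \<in> free_dirs (Q i) (x i)" "g \<noteq> 0"
    and "i' < n" "real_vec g' \<in> free_dirs (Q i') (x i')"
    and eq: "\<And>k. k < r \<Longrightarrow> mat_vec (t i) (A i) g k = mat_vec (t i') (A i') g' k"
  shows "i = i' \<and> g = g'"
proof -
  have "single_block i (real_vec g) - single_block i' (real_vec g') = 0"
    using assms
    by (intro free_dirs_linking_eq_0 subspace_diff[OF subspace_dirs] single_block_free_dirs)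
      (auto simp: linking_diff linking_single_block mat_vec_real_vec)
  then have *: "single_block i (real_vec g) = single_block i' (real_vec g')" by simp
  from fun_cong[OF *, of i] assms(3) show ?thesis by (auto simp flip: real_vec_0 split: if_splits)
qed

lemma free_graver_nonzero:
  assumes "i < n" "real_vec g \<in> free_dirs (Q i) (x i)" "g \<noteq> 0"
  shows "\<exists>k<r. mat_vec (t i) (A i) g k \<noteq> 0"
proof (rule ccontr)
  assume "\<not> ?thesis"
  then have "single_block i (real_vec g) = 0"
    using assms
    by (intro free_dirs_linking_eq_0 single_block_free_dirs) (auto simp: linking_single_block mat_vec_real_vec)
  from fun_cong[OF this, of i] assms(3) show False by (simp flip: real_vec_0)
qed

lemma graver_linking_bound:
  assumes "i < n" "g \<in> graver_basis (s i) (t i) (B i)" "k < r"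
  shows "\<bar>mat_vec (t i) (A i) g k\<bar> \<le> int (D * G)"
  using A_bound graver_norm assms by (intro abs_mat_vec_le) auto

text \<open>The blockwise outcome of \<open>integral_rounding\<close>, packed into one predicate so
  that a single rounding can be fixed for all following lemmas.\<close>

definition rounds :: "(nat \<Rightarrow> nat \<Rightarrow> real) \<Rightarrow> (nat \<Rightarrow> (nat \<Rightarrow> int) set) \<Rightarrow> (nat \<Rightarrow> (nat \<Rightarrow> int) \<Rightarrow> real) \<Rightarrow> bool"
  where "rounds v P c \<longleftrightarrow> v \<in> vecs n \<and> (\<forall>i<n. v i \<in> integer_points (s i) (t i) (B i) (b i) \<and>
    v i - x i \<in> free_dirs (Q i) (x i) \<and> finite (P i) \<and>
    (\<forall>g\<in>P i. g \<in> graver_basis (s i) (t i) (B i) \<and> real_vec g \<in> free_dirs (Q i) (x i) \<and>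
      0 \<le> c i g \<and> c i g \<le> 1) \<and>
    x i - v i = (\<Sum>g\<in>P i. c i g *\<^sub>R real_vec g))"

lemma rounds_exists: "\<exists>v P c. rounds v P c"
proof -
  define R where "R i y P c \<longleftrightarrow> y \<in> integer_points (s i) (t i) (B i) (b i) \<and>
    y - x i \<in> free_dirs (Q i) (x i) \<and> finite P \<and>
    (\<forall>g\<in>P. g \<in> graver_basis (s i) (t i) (B i) \<and> real_vec g \<in> free_dirs (Q i) (x i) \<and>
      0 \<le> c g \<and> c g \<le> 1) \<and>
    x i - y = (\<Sum>g\<in>P. c g *\<^sub>R real_vec g)" for i y P c
  have "\<exists>y P c. R i y P c" if "i < n" for i
    unfolding R_def using x_region that by (intro integral_rounding[OF Q_eq]) (auto simp: region_def)
  then obtain v P c where R: "\<And>i. i < n \<Longrightarrow> R i (v i) (P i) (c i)" by metis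
  have "rounds (\<lambda>i. if i < n then v i else 0) P c"
    using R unfolding rounds_def R_def by (auto simp: vecs_def)
  then show ?thesis by blast
qed

section \<open>Distance from the vertex to its rounding\<close>

context
  fixes v P c
  assumes v: "rounds v P c"
begin

lemma v_vecs: "v \<in> vecs n"
  and v_integer: "i < n \<Longrightarrow> v i \<in> integer_points (s i) (t i) (B i) (b i)"
  and finite_P: "i < n \<Longrightarrow> finite (P i)"
  and P_graver: "i < n \<Longrightarrow> g \<in> P i \<Longrightarrow> g \<in> graver_basis (s i) (t i) (B i)"
  and P_free: "i < n \<Longrightarrow> g \<in> P i \<Longrightarrow> real_vec g \<in> free_dirs (Q i) (x i)"
  and c_bounds: "i < n \<Longrightarrow> g \<in> P i \<Longrightarrow> 0 \<le> c i g \<and> c i g \<le> 1"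
  and x_minus_v: "i < n \<Longrightarrow> x i - v i = (\<Sum>g\<in>P i. c i g *\<^sub>R real_vec g)"
  using v unfolding rounds_def by blast+

lemma v_free: "v - x \<in> free_dirs region x"
  using v x_region by (intro blockwise_free_dirs) (auto simp: rounds_def region_def vecs_def)

text \<open>By \<open>free_pair_unique\<close> the image \<open>sig\<close> identifies a pair, and
  each of its \<open>r\<close> entries is an integer of absolute value at most
  \<open>D * G\<close>.\<close>

lemma card_pairs: "(\<Sum>i<n. card (P i)) \<le> (2 * (D * G) + 1) ^ r"
proof -
  define sig where "sig = (\<lambda>(i, g :: nat \<Rightarrow> int). restrict (mat_vec (t i) (A i) g) {..<r})"
  define X where "X = {..<r} \<rightarrow>\<^sub>E {- int (D * G)..int (D * G)}"
  have P_nonzero: "g \<noteq> 0" if "i < n" "g \<in> P i" for i g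
    using P_graver[OF that] by (simp add: graver_basis_def)
  have "(\<Sum>i<n. card (P i)) = card (Sigma {..<n} P)" using finite_P by simp
  also have "\<dots> \<le> card X"
  proof (rule card_inj_on_le)
    show "inj_on sig (Sigma {..<n} P)"
    proof (rule inj_onI)
      fix p q assume "p \<in> Sigma {..<n} P" "q \<in> Sigma {..<n} P" "sig p = sig q"
      then obtain i g i' g' where pq: "p = (i, g)" "q = (i', g')" and
        *: "i < n" "g \<in> P i" "i' < n" "g' \<in> P i'" "sig (i, g) = sig (i', g')" by blast
      have "mat_vec (t i) (A i) g k = mat_vec (t i') (A i') g' k" if "k < r" for k
        using fun_cong[OF *(5), of k] that by (simp add: sig_def)
      then have "i = i' \<and> g = g'"
        using * P_free P_nonzero by (intro free_pair_unique) auto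
      then show "p = q" using pq by simp
    qed
    show "sig ` Sigma {..<n} P \<subseteq> X"
    proof (rule image_subsetI)
      fix p assume "p \<in> Sigma {..<n} P"
      then obtain i g where "p = (i, g)" "i < n" "g \<in> P i" by blast
      then show "sig p \<in> X"
        using graver_linking_bound[OF _ P_graver] unfolding sig_def X_def
        by (force simp: restrict_PiE_iff abs_le_iff)
    qed
    show "finite X" by (auto simp: X_def intro!: finite_PiE)
  qed
  also have "card X = (2 * (D * G) + 1) ^ r"
  proof -
    have "int (D * G) - - int (D * G) + 1 = int (2 * (D * G) + 1)" by simp
    then have "card {- int (D * G)..int (D * G)} = 2 * (D * G) + 1"
      unfolding card_atLeastAtMost_int by (metis nat_int)
    then show ?thesis by (simp only: X_def card_PiE finite_lessThan prod_constant card_lessThan)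
  qed
  finally show ?thesis .
qed

lemma x_minus_v_norm: "block_norm1 n t (x - v) \<le> real ((2 * (D * G) + 1) ^ r * G)"
proof -
  have "norm1 (t i) ((x - v) i) \<le> real (card (P i)) * G" if i: "i < n" for i
  proof -
    have "norm1 (t i) ((x - v) i) \<le> (\<Sum>g\<in>P i. norm1 (t i) (c i g *\<^sub>R real_vec g))"
      using norm1_sum_le x_minus_v[OF i] by simp
    also have "\<dots> \<le> (\<Sum>g\<in>P i. 1 * real G)"
    proof (intro sum_mono)
      fix g assume g: "g \<in> P i"
      have "norm1 (t i) (real_vec g) \<le> real_of_int (int G)"
        unfolding norm1_real_vec of_int_le_iff using graver_norm[OF i P_graver[OF i g]] .
      then show "norm1 (t i) (c i g *\<^sub>R real_vec g) \<le> 1 * real G"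
        unfolding norm1_scaleR using c_bounds[OF i g] by (intro mult_mono) (auto intro: norm1_nonneg)
    qed
    finally show ?thesis by simp
  qed
  then have "block_norm1 n t (x - v) \<le> (\<Sum>i<n. real (card (P i)) * G)"
    unfolding block_norm1_def by (intro sum_mono) auto
  also have "\<dots> = real ((\<Sum>i<n. card (P i)) * G)" by (simp add: sum_distrib_right)
  also have "\<dots> \<le> real ((2 * (D * G) + 1) ^ r * G)"
    unfolding of_nat_le_iff using card_pairs by (rule mult_right_mono) simp
  finally show ?thesis .
qed

text \<open>Each pair contributes at most \<open>D * G\<close>. The bound has the shape
  \<open>K * M\<close> that \<open>zero_sum_subfamily\<close> expects of the total.\<close>

lemma x_minus_v_linking:
  assumes "k < r"
  shows "\<bar>linking (x - v) k\<bar> \<le> real (D * G * (2 * (D * G) + 1) ^ r)"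
proof -
  have "\<bar>mat_vec (t i) (A i) ((x - v) i) k\<bar> \<le> real (card (P i)) * (D * G)" if i: "i < n" for i
  proof -
    have "mat_vec (t i) (A i) ((x - v) i) k = (\<Sum>g\<in>P i. c i g * mat_vec (t i) (A i) g k)"
      using x_minus_v[OF i] by (simp add: mat_vec_sum mat_vec_scaleR mat_vec_real_vec)
    also have "\<bar>\<dots>\<bar> \<le> (\<Sum>g\<in>P i. 1 * real (D * G))"
    proof (intro order.trans[OF sum_abs] sum_mono)
      fix g assume g: "g \<in> P i"
      have "real_of_int \<bar>mat_vec (t i) (A i) g k\<bar> \<le> real_of_int (int (D * G))"
        unfolding of_int_le_iff using graver_linking_bound[OF i P_graver[OF i g] assms] .
      then show "\<bar>c i g * mat_vec (t i) (A i) g k\<bar> \<le> 1 * real (D * G)"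
        unfolding abs_mult using c_bounds[OF i g] by (intro mult_mono) auto
    qed
    finally show ?thesis by simp
  qed
  then have "\<bar>linking (x - v) k\<bar> \<le> (\<Sum>i<n. real (card (P i)) * (D * G))"
    unfolding linking_def by (intro order.trans[OF sum_abs] sum_mono) auto
  also have "\<dots> = real (D * G * (\<Sum>i<n. card (P i)))" by (simp add: sum_distrib_left mult_ac)
  also have "\<dots> \<le> real (D * G * (2 * (D * G) + 1) ^ r)"
    unfolding of_nat_le_iff using card_pairs by (rule mult_left_mono) simp
  finally show ?thesis .
qed

text \<open>If \<open>r \<Delta> G = 1\<close>, the space of free directions is at most one-dimensional and contains a Graver
  element on which the linking constraint takes the value \<open>\<plusminus>1\<close>; so \<open>x - v\<close> is an integer multiple of it.\<close>

lemma x_integral_if_small: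
  assumes small: "r * D * G \<le> 1" and "i < n" "j < t i"
  shows "x i j \<in> \<int>"
proof (cases "\<forall>i'<n. P i' = {}")
  case True
  then have "x i j = v i j"
    using fun_cong[OF x_minus_v[OF assms(2)], of j] assms(2) by simp
  then show ?thesis using v_integer[OF assms(2)] assms(3) by (simp add: integer_points_def)
next
  case False
  then obtain i' g where g: "i' < n" "g \<in> P i'" by blast
  have "g \<noteq> 0" using P_graver[OF g] by (simp add: graver_basis_def)
  with free_graver_nonzero[OF g(1) P_free[OF g]] obtain k where
    k: "k < r" "mat_vec (t i') (A i') g k \<noteq> 0" by blast
  define \<sigma> where "\<sigma> = mat_vec (t i') (A i') g k"
  have \<sigma>: "\<bar>\<sigma>\<bar> \<ge> 1" "\<bar>\<sigma>\<bar> \<le> int (D * G)"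
    using k(2) graver_linking_bound[OF g(1) P_graver[OF g] k(1)] by (auto simp: \<sigma>_def)
  then have "int (D * G) \<ge> 1" by linarith
  \<comment> \<open>The nonzero image excludes \<open>D * G = 0\<close> and \<open>k < r\<close>
    excludes \<open>r = 0\<close>, so every factor of the product equals 1.\<close>
  then have pos: "D > 0" "G > 0" by (auto intro: Nat.gr0I)
  with small k(1) have "r = 1" "D * G = 1" by (cases r; cases D; cases G; auto)+
  with k(1) \<sigma> have "k = 0" and "\<bar>\<sigma>\<bar> = 1" by auto
  then have "\<sigma> * \<sigma> = 1" by (auto simp: abs_if split: if_splits)
  have "linking v k \<in> \<int>"
    unfolding linking_def mat_vec_def using v_integer
    by (intro Ints_sum Ints_mult) (auto simp: integer_points_def)
  moreover have "linking x k \<in> \<int>" using x_linking[OF k(1)] by simp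
  ultimately obtain m where m: "linking (x - v) k = of_int m"
    unfolding linking_diff by (metis Ints_cases Ints_diff)
  \<comment> \<open>As \<open>\<sigma> * \<sigma> = 1\<close>, subtracting
    \<open>m * \<sigma>\<close> copies of \<open>g\<close> cancels the linking value
    \<open>m\<close>.\<close>
  have "(x - v) - of_int (m * \<sigma>) *\<^sub>R single_block i' (real_vec g) = 0"
  proof (rule free_dirs_linking_eq_0)
    have xv: "x - v \<in> free_dirs region x"
      using subspace_neg[OF subspace_dirs v_free] by simp
    then show "(x - v) - of_int (m * \<sigma>) *\<^sub>R single_block i' (real_vec g) \<in> free_dirs region x"
      using g P_free
      by (intro subspace_diff[OF subspace_dirs xv] subspace_scale[OF subspace_dirs] single_block_free_dirs)
    fix k' assume "k' < r"
    then have "k' = k" using \<open>r = 1\<close> \<open>k = 0\<close> by simp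
    have "real_of_int (m * \<sigma>) * real_of_int \<sigma> = of_int (m * (\<sigma> * \<sigma>))" by simp
    then show "linking (x - v - of_int (m * \<sigma>) *\<^sub>R single_block i' (real_vec g)) k' = 0"
      unfolding linking_diff[of "x - v"] linking_scaleR linking_single_block[OF g(1)] mat_vec_real_vec
        \<open>k' = k\<close> \<sigma>_def[symmetric] m by (simp add: \<open>\<sigma> * \<sigma> = 1\<close>)
  qed
  from fun_cong[OF fun_cong[OF this, of i], of j]
  have "x i j = v i j + of_int (m * \<sigma>) * (if i = i' then real_of_int (g j) else 0)"
    by (simp add: scaleR_fun_def split: if_splits)
  then show ?thesis using v_integer[OF assms(2)] assms(3)
    by (auto simp: integer_points_def intro!: Ints_add Ints_mult)
qed


section \<open>Integer optima near the vertex\<close>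

lemma x_optimal_if_small:
  assumes "r * D * G \<le> 1"
    and "is_arg_max (block_objective n t w) (\<lambda>y. y \<in> lp_feasible n r t A b\<^sub>0 Q) x"
  shows "is_arg_max (block_objective n t w) (\<lambda>y. y \<in> ip_feasible n r t A b\<^sub>0 Q) x"
  using assms(2) x_integral_if_small[OF assms(1)] by (auto simp: is_arg_max_def ip_feasible_def)

text \<open>Linking-neutral conformal parts of \<open>z - v\<close> can be moved from \<open>z\<close> to \<open>x\<close> (after scaling),
  so optimality of both \<open>x\<close> and \<open>z\<close> forces their objective value to vanish.\<close>

lemma remove_neutral_part:
  fixes d u :: "nat \<Rightarrow> nat \<Rightarrow> int"
  assumes x: "is_arg_max (block_objective n t w) (\<lambda>y. y \<in> lp_feasible n r t A b\<^sub>0 Q) x"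
    and z: "is_arg_max (block_objective n t w) (\<lambda>y. y \<in> ip_feasible n r t A b\<^sub>0 Q) z"
    and d: "\<And>i. i < n \<Longrightarrow> d i \<in> int_kernel (s i) (t i) (B i)" "\<And>i. i < n \<Longrightarrow> conformal (d i) (u i)"
    and u: "\<And>i. i < n \<Longrightarrow> z i - v i = real_vec (u i)"
    and outside: "\<And>i. i \<ge> n \<Longrightarrow> d i = 0"
    and neutral: "\<And>k. k < r \<Longrightarrow> linking (\<lambda>i. real_vec (d i)) k = 0"
  shows "is_arg_max (block_objective n t w) (\<lambda>y. y \<in> ip_feasible n r t A b\<^sub>0 Q) (z - (\<lambda>i. real_vec (d i)))"
proof -
  define rd where "rd = (\<lambda>i. real_vec (d i))"
  have z_feas: "z \<in> ip_feasible n r t A b\<^sub>0 Q" using z by (simp add: is_arg_max_def)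
  have rd_vecs: "rd i = 0" if "i \<ge> n" for i using outside[OF that] by (simp add: rd_def)
  have exch: "v i + real_vec (d i) \<in> integer_points (s i) (t i) (B i) (b i) \<and>
      z i - real_vec (d i) \<in> integer_points (s i) (t i) (B i) (b i)" if "i < n" for i
    using z_feas that by (intro integer_points_exchange[OF v_integer _ u d]) (auto simp: ip_feasible_iff)
  have "v i + rd i \<in> Q i" if "i < n" for i
    using exch[OF that] hull_subset[of "integer_points (s i) (t i) (B i) (b i)" convex]
    unfolding Q_eq[OF that] rd_def by blast
  then have "v + rd \<in> region"
    using v_vecs rd_vecs by (simp add: region_def vecs_def)
  from free_dirs_translate[OF convex_region v_free this] obtain e where
    e: "e > 0" "x + e *\<^sub>R rd \<in> region" by blast
  have "x + e *\<^sub>R rd \<in> lp_feasible n r t A b\<^sub>0 Q"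
    unfolding lp_feasible_iff linking_add linking_scaleR
    using e(2) x_linking neutral by (simp add: rd_def)
  with x have "\<not> block_objective n t w x < block_objective n t w (x + e *\<^sub>R rd)"
    unfolding is_arg_max_def by blast
  \<comment> \<open>A positive value of \<open>rd\<close> would improve \<open>x\<close>. Hence
    subtracting \<open>rd\<close> from \<open>z\<close> cannot lower the objective.\<close>
  then have rd_le: "block_objective n t w rd \<le> 0"
    using e(1) unfolding block_objective_add block_objective_scaleR
    by (simp add: not_less mult_le_0_iff)
  have "z - rd \<in> ip_feasible n r t A b\<^sub>0 Q"
    unfolding ip_feasible_iff linking_diff
    using z_feas exch rd_vecs neutral by (simp add: ip_feasible_iff vecs_def rd_def)
  moreover have "block_objective n t w z \<le> block_objective n t w (z - rd)"
    using rd_le block_objective_add[of n t w "z - rd" rd] by simp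
  ultimately show ?thesis
    using z unfolding rd_def[symmetric] is_arg_max_def by (auto intro: order.strict_trans1)
qed

text \<open>A nearest integer optimum admits no nonempty neutral subfamily of pieces, since
  \<open>remove_neutral_part\<close> would bring it closer; so there are fewer than
  \<open>piece_bound\<close> pieces, each of norm at most \<open>G\<close>.\<close>

lemma close_integer_optimum:
  assumes x: "is_arg_max (block_objective n t w) (\<lambda>y. y \<in> lp_feasible n r t A b\<^sub>0 Q) x"
    and ex: "\<exists>y. is_arg_max (block_objective n t w) (\<lambda>y. y \<in> ip_feasible n r t A b\<^sub>0 Q) y"
  shows "\<exists>z. is_arg_max (block_objective n t w) (\<lambda>y. y \<in> ip_feasible n r t A b\<^sub>0 Q) z \<and>
    block_norm1 n t (z - v) \<le> real (piece_bound * G)"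
proof -
  let ?opt = "is_arg_max (block_objective n t w) (\<lambda>y. y \<in> ip_feasible n r t A b\<^sub>0 Q)"
  \<comment> \<open>Distances between integer points are integers, so taking the floor loses nothing
    and a minimum exists.\<close>
  from ex_has_least_nat[of ?opt _ "\<lambda>z. nat \<lfloor>block_norm1 n t (z - v)\<rfloor>"] ex obtain z where
    z: "?opt z" and z_min: "\<And>y. ?opt y \<Longrightarrow> nat \<lfloor>block_norm1 n t (z - v)\<rfloor> \<le> nat \<lfloor>block_norm1 n t (y - v)\<rfloor>"
    by blast
  have z_feas: "z \<in> ip_feasible n r t A b\<^sub>0 Q" using z by (simp add: is_arg_max_def)
  define decomposes where "decomposes i N h u \<longleftrightarrow> z i - v i = real_vec u \<and> u = (\<Sum>l<N. h l) \<and>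
      (\<forall>l<N. h l \<in> graver_basis (s i) (t i) (B i) \<and> conformal (h l) u)" for i u h and N :: nat
  have "\<exists>N h u. decomposes i N h u" if "i < n" for i
  proof -
    have "z i \<in> integer_points (s i) (t i) (B i) (b i)" using z_feas that by (simp add: ip_feasible_iff)
    from integer_points_diff[OF v_integer[OF that] this] obtain u where
      u: "u \<in> int_kernel (s i) (t i) (B i)" "z i - v i = real_vec u" by blast
    obtain N :: nat and h where "u = (\<Sum>l<N. h l)"
        "\<And>l. l < N \<Longrightarrow> h l \<in> graver_basis (s i) (t i) (B i) \<and> conformal (h l) u"
      by (rule graver_decomposition[OF u(1)]) (rule that)
    with u(2) show ?thesis unfolding decomposes_def by blast
  qed
  then obtain N h u where dec': "\<And>i. i < n \<Longrightarrow> decomposes i (N i) (h i) (u i)" by metis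
  have dec: "z i - v i = real_vec (u i)" "u i = (\<Sum>l<N i. h i l)"
      "l < N i \<Longrightarrow> h i l \<in> graver_basis (s i) (t i) (B i)"
      "l < N i \<Longrightarrow> conformal (h i l) (u i)" if "i < n" for i l
    using dec'[OF that] unfolding decomposes_def by blast+
  \<comment> \<open>Pieces are indexed by block and position, so repeated Graver elements count
    separately.\<close>
  define I where "I = Sigma {..<n} (\<lambda>i. {..<N i})"
  have I: "finite I" "card I = (\<Sum>i<n. N i)" by (simp_all add: I_def)
  define a where "a = (\<lambda>(i, l). mat_vec (t i) (A i) (h i l))"
  have norm_z: "block_norm1 n t (z - v) = of_int (\<Sum>i<n. norm1 (t i) (u i))"
    using dec(1) by (intro block_norm1_integral) simp
  have no_neutral: "J = {}" if J: "J \<subseteq> I" "\<And>k. k < r \<Longrightarrow> (\<Sum>p\<in>J. a p k) = 0" for J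
  proof (rule ccontr)
    assume "J \<noteq> {}"
    then obtain i\<^sub>0 l\<^sub>0 where il: "(i\<^sub>0, l\<^sub>0) \<in> J" "i\<^sub>0 < n" "l\<^sub>0 < N i\<^sub>0" using J(1) by (auto simp: I_def)
    define L where "L i = {l. (i, l) \<in> J}" for i
    have L: "L i \<subseteq> {..<N i}" "finite (L i)" for i
    proof -
      show "L i \<subseteq> {..<N i}" using J(1) by (auto simp: L_def I_def)
      then show "finite (L i)" by (rule finite_subset) simp
    qed
    have J_eq: "J = Sigma {..<n} L" using J(1) by (auto simp: L_def I_def)
    define d where "d i = (\<Sum>l\<in>L i. h i l)" for i
    have L_empty: "L i = {}" if "i \<ge> n" for i using that J(1) by (auto simp: L_def I_def)
    have conf: "conformal (d i) (u i)" if "i < n" for i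
      unfolding d_def using dec(4)[OF that] L
      by (intro conformal_sum_subset[OF dec(2)[OF that]]) auto
    let ?z = "z - (\<lambda>i. real_vec (d i))"
    have "?opt ?z"
    proof (rule remove_neutral_part[OF x z _ conf dec(1)])
      show "d i \<in> int_kernel (s i) (t i) (B i)" if "i < n" for i
        unfolding d_def using dec(3)[OF that] L graver_basis_int_kernel by (intro int_kernel_sum) blast
      show "d i = 0" if "i \<ge> n" for i using L_empty[OF that] by (simp add: d_def)
      fix k assume "k < r"
      have "linking (\<lambda>i. real_vec (d i)) k = of_int (\<Sum>i<n. \<Sum>l\<in>L i. a (i, l) k)"
        by (simp add: linking_def mat_vec_real_vec d_def mat_vec_sum a_def)
      also have "(\<Sum>i<n. \<Sum>l\<in>L i. a (i, l) k) = (\<Sum>p\<in>J. a p k)"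
        unfolding J_eq using L(2) by (subst sum.Sigma) (auto simp: split_def)
      finally show "linking (\<lambda>i. real_vec (d i)) k = 0"
        by (simp only: J(2)[OF \<open>k < r\<close>] of_int_0)
    qed
    have norm_z': "block_norm1 n t (?z - v) = of_int (\<Sum>i<n. norm1 (t i) (u i - d i))"
    proof (rule block_norm1_integral)
      fix i assume "i < n"
      have "(?z - v) i = (z i - v i) - real_vec (d i)" by simp
      then show "(?z - v) i = real_vec (u i - d i)" by (simp only: dec(1)[OF \<open>i < n\<close>] real_vec_diff)
    qed
    \<comment> \<open>Removing a conformal part lowers the norm by exactly the norm of that part,
      which is positive in block \<open>i\<^sub>0\<close>.\<close>
    have split: "norm1 (t i) (u i) = norm1 (t i) (d i) + norm1 (t i) (u i - d i)" if "i < n" for i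
      using norm1_conformal_add[of "d i" "u i - d i" "t i"] conf[OF that] by simp
    have "norm1 (t i\<^sub>0) (d i\<^sub>0) > 0"
    proof -
      have "norm1 (t i\<^sub>0) (d i\<^sub>0) = (\<Sum>l\<in>L i\<^sub>0. norm1 (t i\<^sub>0) (h i\<^sub>0 l))"
        unfolding d_def using dec(4)[OF il(2)] L by (intro norm1_conformal_sum) auto
      moreover have "norm1 (t i\<^sub>0) (h i\<^sub>0 l\<^sub>0) > 0"
        using dec(3)[OF il(2,3)] by (intro norm1_pos) (auto simp: graver_basis_def int_kernel_def)
      moreover have "l\<^sub>0 \<in> L i\<^sub>0" using il by (simp add: L_def)
      ultimately show ?thesis using L(2) by (auto intro!: sum_pos2 norm1_nonneg)
    qed
    then have "(\<Sum>i<n. norm1 (t i) (u i - d i)) < (\<Sum>i<n. norm1 (t i) (u i))"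
      using il(2) split by (intro sum_strict_mono_ex1) (auto simp: norm1_nonneg intro!: bexI[of _ i\<^sub>0])
    moreover have "0 \<le> (\<Sum>i<n. norm1 (t i) (u i - d i))" by (intro sum_nonneg norm1_nonneg)
    ultimately show False using z_min[OF \<open>?opt ?z\<close>] unfolding norm_z norm_z' floor_of_int by linarith
  qed
  have "card I < piece_bound"
  proof (rule ccontr)
    assume "\<not> card I < piece_bound"
    then have big: "card I \<ge> ((2 * (D * G) + 1) ^ r + 1) * (4 * (D * G) * r + 2 * (D * G) + 2) ^ r"
      by (simp add: piece_bound_def)
    have "\<exists>J\<subseteq>I. J \<noteq> {} \<and> (\<forall>k<r. (\<Sum>p\<in>J. a p k) = 0)"
    proof (rule zero_sum_subfamily[OF I(1) _ _ _ big])
      show "\<forall>p\<in>I. \<forall>k<r. \<bar>a p k\<bar> \<le> int (D * G)"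
        using dec(3) graver_linking_bound by (auto simp: I_def a_def simp del: of_nat_mult)
      show "\<forall>k<r. \<bar>\<Sum>p\<in>I. a p k\<bar> \<le> int (D * G * (2 * (D * G) + 1) ^ r)"
      proof (intro allI impI)
        fix k assume k: "k < r"
        have "(\<Sum>p\<in>I. a p k) = (\<Sum>i<n. \<Sum>l<N i. a (i, l) k)"
          unfolding I_def by (subst sum.Sigma) (auto simp: split_def)
        also have "\<dots> = (\<Sum>i<n. mat_vec (t i) (A i) (u i) k)"
          by (intro sum.cong) (simp_all add: dec(2) mat_vec_sum a_def)
        finally have "real_of_int (\<Sum>p\<in>I. a p k) = linking (z - v) k"
          using dec(1) by (simp add: linking_def mat_vec_real_vec)
        \<comment> \<open>Both \<open>z\<close> and \<open>x\<close> satisfy the linking constraints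
          with the same right-hand side.\<close>
        also have "\<dots> = linking (x - v) k"
          using z_feas k x_linking by (simp add: linking_diff ip_feasible_iff)
        finally have "real_of_int \<bar>\<Sum>p\<in>I. a p k\<bar> \<le> real_of_int (int (D * G * (2 * (D * G) + 1) ^ r))"
          using x_minus_v_linking[OF k] by simp
        then show "\<bar>\<Sum>p\<in>I. a p k\<bar> \<le> int (D * G * (2 * (D * G) + 1) ^ r)"
          unfolding of_int_le_iff .
      qed
    qed simp
    with no_neutral show False by blast
  qed
  have "norm1 (t i) (u i) \<le> int (N i * G)" if i: "i < n" for i
  proof -
    have "norm1 (t i) (u i) \<le> (\<Sum>l<N i. norm1 (t i) (h i l))"
      by (subst dec(2)[OF i]) (rule norm1_sum_le)
    also have "\<dots> \<le> (\<Sum>l<N i. int G)"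
      using graver_norm[OF i] dec(3)[OF i] by (intro sum_mono) auto
    finally show ?thesis by simp
  qed
  then have "(\<Sum>i<n. norm1 (t i) (u i)) \<le> (\<Sum>i<n. int (N i * G))" by (intro sum_mono) auto
  also have "\<dots> = int (card I * G)" by (simp add: I(2) sum_distrib_right)
  also have "\<dots> \<le> int (piece_bound * G)"
    using \<open>card I < piece_bound\<close> unfolding of_nat_le_iff by (intro mult_right_mono) auto
  finally have "real_of_int (\<Sum>i<n. norm1 (t i) (u i)) \<le> real_of_int (int (piece_bound * G))"
    unfolding of_int_le_iff .
  with z norm_z show ?thesis by auto
qed

end

section \<open>Absorbing constants into the exponent\<close>

text \<open>With base \<open>q \<ge> 2\<close> constant factors become powers: the two bases are at
  most \<open>4 * q \<le> q ^ 3\<close> and \<open>8 * q \<le> q ^ 4\<close>. Together with the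
  remaining factors this gives exponent \<open>7 * r + 3\<close>, at most \<open>10 * r\<close>
  because \<open>r \<ge> 1\<close>.\<close>

lemma proximity_bound_power:
  assumes "r * D * G \<ge> 2"
  shows "(2 * (D * G) + 1) ^ r * G + piece_bound * G \<le> (r * D * G) ^ (10 * r)"
proof -
  define q where "q = r * D * G"
  have pos: "r \<ge> 1" "D \<ge> 1" "G \<ge> 1" using assms by (auto intro!: Suc_leI Nat.gr0I)
  have q: "q \<ge> 2" using assms by (simp add: q_def)
  have "1 * (D * G) \<le> r * (D * G)" using pos by (intro mult_right_mono) auto
  then have DG: "D * G \<le> q" by (simp add: q_def mult.assoc)
  have "1 * G \<le> r * D * G" using pos by (intro mult_right_mono) auto
  then have "G \<le> q" by (simp add: q_def)
  have pow: "2 ^ m * q \<le> q ^ Suc m" for m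
  proof -
    have "2 ^ m * q \<le> q ^ m * q" using q by (intro mult_right_mono power_mono) auto
    then show ?thesis by (simp add: mult.commute)
  qed
  have "2 * (D * G) + 1 \<le> 2 ^ 2 * q" using DG q by simp
  also have "\<dots> \<le> q ^ 3" using pow[of 2] by (simp add: numeral_3_eq_3)
  finally have "(2 * (D * G) + 1) ^ r \<le> (q ^ 3) ^ r" by (intro power_mono) auto
  then have M: "(2 * (D * G) + 1) ^ r \<le> q ^ (3 * r)" by (simp add: power_mult)
  have "1 \<le> q ^ (3 * r)" using q by simp
  with M have "(2 * (D * G) + 1) ^ r + 1 \<le> 2 * q ^ (3 * r)" by linarith
  also have "\<dots> \<le> q * q ^ (3 * r)" using q by (intro mult_right_mono) auto
  finally have M1: "(2 * (D * G) + 1) ^ r + 1 \<le> q ^ (3 * r + 1)" by simp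
  have "4 * (D * G) * r = 4 * q" by (simp add: q_def mult_ac)
  then have "4 * (D * G) * r + 2 * (D * G) + 2 \<le> 2 ^ 3 * q" using DG q by simp
  also have "\<dots> \<le> q ^ 4" using pow[of 3] by (simp add: eval_nat_numeral)
  finally have "(4 * (D * G) * r + 2 * (D * G) + 2) ^ r \<le> (q ^ 4) ^ r" by (intro power_mono) auto
  then have "(4 * (D * G) * r + 2 * (D * G) + 2) ^ r \<le> q ^ (4 * r)" by (simp add: power_mult)
  with M1 have pb: "piece_bound \<le> q ^ (3 * r + 1) * q ^ (4 * r)"
    unfolding piece_bound_def by (intro mult_mono) auto
  have "(2 * (D * G) + 1) ^ r + piece_bound \<le> q ^ (3 * r + 1 + 4 * r) + q ^ (3 * r + 1 + 4 * r)"
  proof (rule add_mono)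
    show "(2 * (D * G) + 1) ^ r \<le> q ^ (3 * r + 1 + 4 * r)"
      using q by (intro order.trans[OF M] power_increasing) auto
  qed (use pb in \<open>simp only: power_add\<close>)
  also have "\<dots> = 2 * q ^ (3 * r + 1 + 4 * r)" by (rule mult_2[symmetric])
  also have "\<dots> \<le> q * q ^ (3 * r + 1 + 4 * r)" using q by (rule mult_right_mono) simp
  finally have "((2 * (D * G) + 1) ^ r + piece_bound) * G \<le> q * q ^ (3 * r + 1 + 4 * r) * q"
    using \<open>G \<le> q\<close> by (rule mult_mono) auto
  also have "\<dots> = q ^ (7 * r + 3)" by (simp add: power_add eval_nat_numeral mult_ac)
  also have "\<dots> \<le> q ^ (10 * r)" using q pos by (intro power_increasing) auto
  finally show ?thesis by (simp add: q_def algebra_simps)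
qed

end

theorem theorem3:
  shows "\<exists>C::nat. \<forall>(n::nat) (r::nat) (t::nat \<Rightarrow> nat) (s::nat \<Rightarrow> nat)
      (c::nat \<Rightarrow> nat \<Rightarrow> real) (A::nat \<Rightarrow> nat \<Rightarrow> nat \<Rightarrow> int) (b\<^sub>0::nat \<Rightarrow> int)
      (B::nat \<Rightarrow> nat \<Rightarrow> nat \<Rightarrow> int) (b::nat \<Rightarrow> nat \<Rightarrow> int) (Q::nat \<Rightarrow> (nat \<Rightarrow> real) set)
      (\<Delta>::nat) (G::nat) (x::nat \<Rightarrow> nat \<Rightarrow> real).
    (\<forall>i<n. Q i = convex hull integer_points (s i) (t i) (B i) (b i)) \<longrightarrow>
    (\<forall>i<n. \<forall>u \<in> graver_basis (s i) (t i) (B i). norm1 (t i) u \<le> int G) \<longrightarrow>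
    (\<forall>i<n. \<forall>k<r. \<forall>j<t i. \<bar>A i k j\<bar> \<le> int \<Delta>) \<longrightarrow>
    x extreme_point_of lp_feasible n r t A b\<^sub>0 Q \<longrightarrow>
    is_arg_max (block_objective n t c) (\<lambda>y. y \<in> lp_feasible n r t A b\<^sub>0 Q) x \<longrightarrow>
    (\<exists>y. is_arg_max (block_objective n t c) (\<lambda>z. z \<in> ip_feasible n r t A b\<^sub>0 Q) y) \<longrightarrow>
    (\<exists>z. is_arg_max (block_objective n t c) (\<lambda>y. y \<in> ip_feasible n r t A b\<^sub>0 Q) z \<and>
         block_norm1 n t (x - z) \<le> real ((r * \<Delta> * G) ^ (C * r)))"
proof (rule exI[of _ 10], intro allI impI, goal_cases)
  case (1 n r t s c A b\<^sub>0 B b Q \<Delta> G x)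
  interpret block_lp n r t s A B b\<^sub>0 b Q \<Delta> G x
    using 1(1-4) by unfold_locales auto
  obtain v P k where v: "rounds v P k" using rounds_exists by blast
  show ?case
  \<comment> \<open>A base of at most 1 cannot absorb constant factors; in that case
    \<open>x\<close> is itself an integer optimum and the distance is zero.\<close>
  proof (cases "r * \<Delta> * G \<le> 1")
    case True
    have "block_norm1 n t (x - x) = 0" by (simp add: block_norm1_def norm1_def)
    with x_optimal_if_small[OF v True 1(5)] show ?thesis
      by (intro exI[of _ x]) auto
  next
    case False
    from close_integer_optimum[OF v 1(5,6)] obtain z where
      z: "is_arg_max (block_objective n t c) (\<lambda>y. y \<in> ip_feasible n r t A b\<^sub>0 Q) z"
        "block_norm1 n t (z - v) \<le> real (piece_bound * G)" by blast
    have "block_norm1 n t (v - z) = block_norm1 n t (z - v)"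
      by (simp add: block_norm1_def norm1_def abs_minus_commute)
    then have "block_norm1 n t (x - z) \<le> block_norm1 n t (x - v) + block_norm1 n t (z - v)"
      using block_norm1_triangle[of n t "x - v" "v - z"] by simp
    also have "\<dots> \<le> real ((2 * (\<Delta> * G) + 1) ^ r * G) + real (piece_bound * G)"
      using x_minus_v_norm[OF v] z(2) by (intro add_mono)
    also have "\<dots> \<le> real ((r * \<Delta> * G) ^ (10 * r))"
      unfolding of_nat_add[symmetric] of_nat_le_iff using False by (intro proximity_bound_power) auto
    finally show ?thesis using z(1) by blast
  qed
qed

end
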